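(* There exists an algorithm which takes as input $(\boldsymbol{g},F)$, where $F=(F_1,\ldots,F_k)$ is a tuple of polynomial maps $F_1,\ldots,F_k:\mathbb{C}^n\to\mathbb{C}^n$ with coefficients in $\mathbb{Q}$ and $\boldsymbol{g}=(g_1,\ldots,g_m)$ is a sequence of polynomials in $\mathbb{Q}[x_1,\ldots,x_n]$, and which terminates and outputs a finite sequence of polynomials whose common vanishing set in $\mathbb{C}^n$ is the invariant set $S_{(F,\mathbf{V}(\boldsymbol{g}))}$.
   Context: $\mathbf{V}(\boldsymbol{g})\subset\mathbb{C}^n$ is the common complex zero set of $\boldsymbol{g}$. For maps $F_1,\ldots,F_k:\mathbb{C}^n\to\mathbb{C}^n$ and $X\subset\mathbb{C}^n$, the invariant set of $((F_1,\ldots,F_k),X)$ is $$S_{((F_1,\ldots,F_k),X)}=\{x\in X\mid \forall m\in\mathbb{N},\ \forall i_1,\ldots,i_m\in\{1,\ldots,k\},\ F_{i_m}(\cdots(F_{i_1}(x)))\in X\}.$$ *)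

theory Defs
  imports Complex_Main "HOL-Library.Poly_Mapping" "HOL-Library.Nat_Bijection"
    "Jordan_Normal_Form.Matrix"
begin

section \<open>Polynomials over the rationals and their zero sets\<close>

text \<open>
  A monomial is a finitely supported exponent function and a polynomial a finitely supported
  map from monomials to coefficients; multiplication on \<^typ>\<open>(nat \<Rightarrow>\<^sub>0 nat) \<Rightarrow>\<^sub>0 rat\<close> is the
  convolution product. The indeterminates are numbered from 0. Points of $n$-dimensional complex
  space are the elements of \<^term>\<open>carrier_vec n :: complex vec set\<close>.
\<close>

type_synonym qpoly = "(nat \<Rightarrow>\<^sub>0 nat) \<Rightarrow>\<^sub>0 rat"

definition qpolys :: "nat \<Rightarrow> qpoly set" where
  "qpolys n = {p. \<forall>m \<in> Poly_Mapping.keys p. Poly_Mapping.keys m \<subseteq> {..<n}}"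

definition peval :: "qpoly \<Rightarrow> complex vec \<Rightarrow> complex" where
  "peval p x = (\<Sum>m \<in> Poly_Mapping.keys p. of_rat (Poly_Mapping.lookup p m) *
      (\<Prod>i \<in> Poly_Mapping.keys m. (x $ i) ^ Poly_Mapping.lookup m i))"

definition zero_set :: "nat \<Rightarrow> qpoly list \<Rightarrow> complex vec set" where
  "zero_set n gs = {x \<in> carrier_vec n. \<forall>g \<in> set gs. peval g x = 0}"

definition qpoly_maps :: "nat \<Rightarrow> qpoly list set" where
  "qpoly_maps n = {f. length f = n \<and> set f \<subseteq> qpolys n}"

definition poly_map :: "qpoly list \<Rightarrow> complex vec \<Rightarrow> complex vec" where
  "poly_map f x = vec (length f) (\<lambda>i. peval (f ! i) x)"


section \<open>Invariant sets\<close>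

text \<open>
  The list \<open>is\<close> is the sequence of indices, of arbitrary length, and
  \<^term>\<open>fold (\<lambda>i. Fs ! i) [i, j] x = (Fs ! j) ((Fs ! i) x)\<close>. The maps are numbered from 0.
\<close>

definition invariant_set :: "('a \<Rightarrow> 'a) list \<Rightarrow> 'a set \<Rightarrow> 'a set" where
  "invariant_set Fs X =
     {x \<in> X. \<forall>is. set is \<subseteq> {..<length Fs} \<longrightarrow> fold (\<lambda>i. Fs ! i) is x \<in> X}"


section \<open>Algorithms\<close>

text \<open>
  The model of computation is that of Kleene's partial recursive functions:
  \<open>evals P xs y\<close> says that the program \<open>P\<close> halts on the arguments \<open>xs\<close> with result \<open>y\<close>.
  In a primitive recursion and in a minimisation, the first argument is the one recursed on,
  respectively the one searched for.
\<close>

datatype recf =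
    ZeroF
  | SuccF
  | ProjF nat
  | CompF recf "recf list"
  | PrecF recf recf
  | MuF recf

inductive evals :: "recf \<Rightarrow> nat list \<Rightarrow> nat \<Rightarrow> bool" where
  evals_Zero: "evals ZeroF xs 0"
| evals_Succ: "evals SuccF (x # xs) (Suc x)"
| evals_Proj: "i < length xs \<Longrightarrow> evals (ProjF i) xs (xs ! i)"
| evals_Comp: "length ys = length gs \<Longrightarrow> \<forall>i < length gs. evals (gs ! i) xs (ys ! i) \<Longrightarrow>
    evals f ys z \<Longrightarrow> evals (CompF f gs) xs z"
| evals_Prec_0: "evals f xs z \<Longrightarrow> evals (PrecF f g) (0 # xs) z"
| evals_Prec_Suc: "evals (PrecF f g) (n # xs) y \<Longrightarrow> evals g (n # y # xs) z \<Longrightarrow>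
    evals (PrecF f g) (Suc n # xs) z"
| evals_Mu: "evals f (n # xs) 0 \<Longrightarrow> \<forall>i < n. \<exists>y > 0. evals f (i # xs) y \<Longrightarrow>
    evals (MuF f) xs n"

inductive_cases evals_ZeroE: "evals ZeroF xs y"
inductive_cases evals_SuccE: "evals SuccF xs y"
inductive_cases evals_ProjE: "evals (ProjF i) xs y"
inductive_cases evals_CompE: "evals (CompF f gs) xs y"
inductive_cases evals_Prec_0E: "evals (PrecF f g) (0 # xs) y"
inductive_cases evals_Prec_SucE: "evals (PrecF f g) (Suc n # xs) y"
inductive_cases evals_MuE: "evals (MuF f) xs y"

lemma evals_deterministic: "evals P xs y \<Longrightarrow> evals P xs z \<Longrightarrow> y = z"
proof (induction arbitrary: z rule: evals.induct)
  case (evals_Comp ys gs xs f y)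
  from evals_Comp.prems obtain ys' where
    ys': "length ys' = length gs" "\<forall>i < length gs. evals (gs ! i) xs (ys' ! i)" "evals f ys' z"
    by (elim evals_CompE) blast
  have "ys = ys'"
    using evals_Comp.hyps evals_Comp.IH(1) ys'(1,2) by (intro nth_equalityI) auto
  with ys'(3) evals_Comp.IH(2) show ?case by blast
next
  case (evals_Prec_Suc f g n xs y w)
  from evals_Prec_Suc.prems obtain y' where
    "evals (PrecF f g) (n # xs) y'" "evals g (n # y' # xs) z"
    by (elim evals_Prec_SucE) blast
  with evals_Prec_Suc.IH show ?case by blast
next
  case (evals_Mu f n xs)
  from evals_Mu.prems have z: "evals f (z # xs) 0" "\<forall>i < z. \<exists>y > 0. evals f (i # xs) y"
    by (auto elim: evals_MuE)
  show ?case
  proof (cases n z rule: linorder_cases)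
    case less
    with z(2) evals_Mu.IH(1) show ?thesis by fastforce
  next
    case greater
    with z(1) evals_Mu.IH(2) show ?thesis by fastforce
  qed
qed (blast elim: evals_ZeroE evals_SuccE evals_ProjE evals_Prec_0E)+


section \<open>Inputs and outputs as natural numbers\<close>

text \<open>
  A polynomial is presented sparsely, as a list of terms. A term \<open>(e, a, b)\<close> consists of the
  list \<open>e\<close> of the exponents of all $n$ indeterminates and of the numerator \<open>a\<close> and the positive
  denominator \<open>b\<close> of its coefficient. Presentations are not unique: fractions need not be reduced
  and monomials may be repeated, in any order, so a polynomial has many codes.
\<close>

type_synonym qterm = "nat list \<times> int \<times> nat"

definition qterms :: "nat \<Rightarrow> qterm set" where
  "qterms n = {(e, a, b). length e = n \<and> b > 0}"

definition qterm_poly :: "qterm \<Rightarrow> qpoly" where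
  "qterm_poly = (\<lambda>(e, a, b). Poly_Mapping.single (Poly_Mapping.nth e) (of_int a / of_nat b))"

definition qterm_encode :: "qterm \<Rightarrow> nat" where
  "qterm_encode = (\<lambda>(e, a, b). prod_encode (list_encode e, prod_encode (int_encode a, b)))"

definition codes_poly :: "nat \<Rightarrow> nat \<Rightarrow> qpoly \<Rightarrow> bool" where
  "codes_poly n c p \<longleftrightarrow>
     (\<exists>ts. set ts \<subseteq> qterms n \<and> c = list_encode (map qterm_encode ts) \<and>
           p = sum_list (map qterm_poly ts))"

definition codes_list :: "(nat \<Rightarrow> 'a \<Rightarrow> bool) \<Rightarrow> nat \<Rightarrow> 'a list \<Rightarrow> bool" where
  "codes_list R c xs \<longleftrightarrow> (\<exists>cs. c = list_encode cs \<and> list_all2 R cs xs)"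

definition codes_input :: "nat \<Rightarrow> nat \<Rightarrow> qpoly list \<Rightarrow> qpoly list list \<Rightarrow> bool" where
  "codes_input c n gs Fs \<longleftrightarrow>
     (\<exists>cg cF. c = prod_encode (n, prod_encode (cg, cF)) \<and>
        codes_list (codes_poly n) cg gs \<and> codes_list (codes_list (codes_poly n)) cF Fs)"

text \<open>The polynomials in $n$ indeterminates are exactly those that have a code.\<close>

lemma ex_codes_poly_iff: "(\<exists>c. codes_poly n c p) \<longleftrightarrow> p \<in> qpolys n"
proof
  assume "\<exists>c. codes_poly n c p"
  then obtain ts where ts: "set ts \<subseteq> qterms n" and p: "p = sum_list (map qterm_poly ts)"
    by (auto simp: codes_poly_def)
  from ts have "sum_list (map qterm_poly ts) \<in> qpolys n"
  proof (induction ts)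
    case Nil
    show ?case by (simp add: qpolys_def)
  next
    case (Cons t ts)
    obtain e a b where t: "t = (e, a, b)" by (cases t) auto
    have "Poly_Mapping.keys (Poly_Mapping.nth e) \<subseteq> {..<n}"
      using Cons.prems t by (auto simp: qterms_def in_keys_iff nth_default_def simp del: keys_nth split: if_splits)
    then have "qterm_poly t \<in> qpolys n"
      by (simp add: t qterm_poly_def qpolys_def)
    moreover have "sum_list (map qterm_poly ts) \<in> qpolys n" using Cons by simp
    ultimately show ?case
      using Poly_Mapping.keys_add[of "qterm_poly t" "sum_list (map qterm_poly ts)"]
      by (fastforce simp: qpolys_def)
  qed
  with p show "p \<in> qpolys n" by simp
next
  assume p: "p \<in> qpolys n"
  obtain ms where ms: "set ms = Poly_Mapping.keys p" "distinct ms"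
    using finite_distinct_list[OF Poly_Mapping.finite_keys[of p]] by blast
  define t :: "(nat \<Rightarrow>\<^sub>0 nat) \<Rightarrow> qterm" where
    "t = (\<lambda>m. (map (Poly_Mapping.lookup m) [0..<n],
          fst (quotient_of (Poly_Mapping.lookup p m)),
          nat (snd (quotient_of (Poly_Mapping.lookup p m)))))"
  have tm: "qterm_poly (t m) = Poly_Mapping.single m (Poly_Mapping.lookup p m)"
    if "m \<in> Poly_Mapping.keys p" for m
  proof -
    from p that have k: "Poly_Mapping.keys m \<subseteq> {..<n}" by (auto simp: qpolys_def)
    have "Poly_Mapping.nth (map (Poly_Mapping.lookup m) [0..<n]) = m"
      using k by (intro poly_mapping_eqI) (auto simp: nth_default_def in_keys_iff)
    moreover have "of_int (fst (quotient_of q)) / of_nat (nat (snd (quotient_of q))) = q"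
      for q :: rat
      using quotient_of_div[of q "fst (quotient_of q)" "snd (quotient_of q)"]
        quotient_of_denom_pos'[of q] by simp
    ultimately show ?thesis by (simp add: t_def qterm_poly_def)
  qed
  have "set (map t ms) \<subseteq> qterms n"
    using quotient_of_denom_pos' by (auto simp: t_def qterms_def)
  moreover have "p = sum_list (map qterm_poly (map t ms))"
  proof -
    have "sum_list (map qterm_poly (map t ms)) =
        (\<Sum>m \<in> Poly_Mapping.keys p. Poly_Mapping.single m (Poly_Mapping.lookup p m))"
      using ms tm by (simp add: sum_list_distinct_conv_sum_set)
    also have "\<dots> = p"
      by (intro poly_mapping_eqI) (simp add: lookup_sum lookup_single when_def in_keys_iff)
    finally show ?thesis by simp
  qed
  ultimately show "\<exists>c. codes_poly n c p" unfolding codes_poly_def by blast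
qed

end

theory Submission
  imports Defs
begin

text \<open>
  Put $H_0 = g$ and let $H_{N+1}$ consist of $g$ and of all $h \circ F_i$ with $h \in H_N$. The zero
  sets of the $H_N$ decrease and their intersection is the invariant set. As soon as $H_{N+1}$ is
  contained in the ideal generated by $H_N$, the zero set of $H_N$ is mapped into itself by every
  $F_i$, so it is the invariant set. By Hilbert's basis theorem this happens for some $N$. No
  Groebner bases are needed to detect it: the algorithm searches blindly for a pair of a number
  $N$ and a list of explicit representations of the elements of $H_{N+1}$ as combinations of elements
  of $H_N$, which it verifies by comparing coefficients.

  The basis theorem is used for ascending chains only. A chain that never stabilises yields
  polynomials $f_0, f_1, \dots$ with $f_N$ in the ideal of $H_{N+1}$ but not in that of $H_N$, and with
  lexicographically least leading monomial among these. Dickson's lemma provides $i < j$ such that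
  the leading monomial of $f_i$ divides that of $f_j$, and reducing $f_j$ by $f_i$ contradicts minimality.
\<close>

section \<open>Functions computed by programs\<close>

text \<open>\<open>f\<close> takes the whole argument list and only lists of length \<open>k\<close>
  matter, so that functions can be written as ordinary terms in the entries \<open>xs ! i\<close>
  and their programs assembled by closure rules.\<close>

definition recfun :: "nat \<Rightarrow> (nat list \<Rightarrow> nat) \<Rightarrow> bool" where
  "recfun k f \<longleftrightarrow> (\<exists>P. \<forall>xs. length xs = k \<longrightarrow> evals P xs (f xs))"

lemma recfun_cong: "recfun k f \<Longrightarrow> (\<And>xs. length xs = k \<Longrightarrow> f xs = g xs) \<Longrightarrow> recfun k g"
  by (auto simp: recfun_def)

lemma recfun_zero: "recfun k (\<lambda>xs. 0)"
  using evals_Zero by (auto simp: recfun_def)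

lemma recfun_nth: "i < k \<Longrightarrow> recfun k (\<lambda>xs. xs ! i)"
  using evals_Proj by (auto simp: recfun_def)

lemma recfun_comp:
  assumes "recfun (length fs) g" "\<forall>f\<in>set fs. recfun k f"
  shows "recfun k (\<lambda>xs. g (map (\<lambda>f. f xs) fs))"
proof -
  obtain G where G: "\<And>xs. length xs = length fs \<Longrightarrow> evals G xs (g xs)"
    using assms(1) by (auto simp: recfun_def)
  obtain P where P: "\<And>f xs. f \<in> set fs \<Longrightarrow> length xs = k \<Longrightarrow> evals (P f) xs (f xs)"
    using assms(2) unfolding recfun_def by metis
  have "evals (CompF G (map P fs)) xs (g (map (\<lambda>f. f xs) fs))" if "length xs = k" for xs
    by (rule evals_Comp[where ys = "map (\<lambda>f. f xs) fs"]) (use that P G in auto)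
  then show ?thesis unfolding recfun_def by blast
qed

lemma recfun_Suc: "recfun k f \<Longrightarrow> recfun k (\<lambda>xs. Suc (f xs))"
proof -
  assume f: "recfun k f"
  have "evals SuccF xs (Suc (xs ! 0))" if "length xs = 1" for xs
    using that evals_Succ by (cases xs) auto
  then have "recfun (length [f]) (\<lambda>xs. Suc (xs ! 0))" by (auto simp: recfun_def)
  from recfun_comp[OF this] f show ?thesis by simp
qed

lemma recfun_rec_nat:
  assumes f: "recfun k f" and h: "recfun (Suc (Suc k)) h" and m: "recfun k m"
  shows "recfun k (\<lambda>xs. rec_nat (f xs) (\<lambda>n y. h (n # y # xs)) (m xs))"
proof -
  obtain F where F: "\<And>xs. length xs = k \<Longrightarrow> evals F xs (f xs)"
    using f by (auto simp: recfun_def)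
  obtain H where H: "\<And>xs. length xs = Suc (Suc k) \<Longrightarrow> evals H xs (h xs)"
    using h by (auto simp: recfun_def)
  have "evals (PrecF F H) (n # xs) (rec_nat (f xs) (\<lambda>n y. h (n # y # xs)) n)"
    if "length xs = k" for n xs
    using that by (induction n) (auto intro!: evals_Prec_0 evals_Prec_Suc F H)
  then have "evals (PrecF F H) xs (rec_nat (f (tl xs)) (\<lambda>n y. h (n # y # tl xs)) (hd xs))"
    if "length xs = Suc k" for xs
    using that by (cases xs) auto
  \<comment> \<open>The program for the recursion has the counter as an extra first argument;
    composing it with \<open>m\<close> and the \<open>k\<close> projections returns to arity
    \<open>k\<close>.\<close>
  then have "recfun (length (m # map (\<lambda>i xs. xs ! i) [0..<k]))
      (\<lambda>xs. rec_nat (f (tl xs)) (\<lambda>n y. h (n # y # tl xs)) (hd xs))"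
    unfolding recfun_def by auto
  from recfun_comp[OF this] m
  have "recfun k (\<lambda>xs. rec_nat (f (map (\<lambda>i. xs ! i) [0..<k]))
      (\<lambda>n y. h (n # y # map (\<lambda>i. xs ! i) [0..<k])) (m xs))"
    by (auto simp: recfun_nth comp_def)
  then show ?thesis by (rule recfun_cong) (auto simp: map_nth)
qed

lemma recfun_Least:
  assumes "recfun (Suc k) f" and ex: "\<And>xs. length xs = k \<Longrightarrow> \<exists>n. f (n # xs) = 0"
  shows "recfun k (\<lambda>xs. LEAST n. f (n # xs) = 0)"
proof -
  obtain F where F: "\<And>xs. length xs = Suc k \<Longrightarrow> evals F xs (f xs)"
    using assms(1) by (auto simp: recfun_def)
  have "evals (MuF F) xs (LEAST n. f (n # xs) = 0)" if xs: "length xs = k" for xs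
  proof (rule evals_Mu)
    show "evals F ((LEAST n. f (n # xs) = 0) # xs) 0"
      using F[of "(LEAST n. f (n # xs) = 0) # xs"] xs LeastI_ex[OF ex[OF xs]] by simp
    show "\<forall>i<LEAST n. f (n # xs) = 0. \<exists>y>0. evals F (i # xs) y"
      using F xs not_less_Least[of _ "\<lambda>n. f (n # xs) = 0"] by (metis gr0I length_Cons)
  qed
  then show ?thesis unfolding recfun_def by blast
qed

section \<open>Arithmetic and the pairing function\<close>

lemma recfun_add: "recfun k f \<Longrightarrow> recfun k g \<Longrightarrow> recfun k (\<lambda>xs. f xs + g xs)"
proof -
  assume f: "recfun k f" and g: "recfun k g"
  have "recfun k (\<lambda>xs. rec_nat (g xs) (\<lambda>n y. Suc ((n # y # xs) ! 1)) (f xs))"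
    by (intro recfun_rec_nat recfun_Suc recfun_nth f g) simp
  moreover have "rec_nat b (\<lambda>n y. Suc y) a = a + b" for a b by (induction a) auto
  ultimately show ?thesis by simp
qed

lemma recfun_diff: "recfun k f \<Longrightarrow> recfun k g \<Longrightarrow> recfun k (\<lambda>xs. f xs - g xs)"
proof -
  assume f: "recfun k f" and g: "recfun k g"
  \<comment> \<open>The predecessor is the recursion that returns the counter and forgets the
    previous value; subtraction iterates it.\<close>
  have pred: "recfun k (\<lambda>xs. f xs - 1)" if "recfun k f" for k f
  proof -
    have "recfun k (\<lambda>xs. rec_nat 0 (\<lambda>n y. (n # y # xs) ! 0) (f xs))"
      by (intro recfun_rec_nat recfun_zero recfun_nth that) simp
    moreover have "rec_nat 0 (\<lambda>n y. n) a = a - 1" for a :: nat by (cases a) auto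
    ultimately show ?thesis by simp
  qed
  have "recfun k (\<lambda>xs. rec_nat (f xs) (\<lambda>n y. (n # y # xs) ! 1 - 1) (g xs))"
    by (intro recfun_rec_nat pred recfun_nth f g) simp
  moreover have "rec_nat a (\<lambda>n y. y - Suc 0) b = a - b" for a b by (induction b) auto
  ultimately show ?thesis by simp
qed

lemma recfun_triangle: "recfun k f \<Longrightarrow> recfun k (\<lambda>xs. triangle (f xs))"
proof -
  assume f: "recfun k f"
  have "recfun k (\<lambda>xs. rec_nat 0 (\<lambda>n y. (n # y # xs) ! 1 + Suc ((n # y # xs) ! 0)) (f xs))"
    by (intro recfun_rec_nat recfun_add recfun_zero recfun_Suc recfun_nth f) simp_all
  moreover have "rec_nat 0 (\<lambda>n y. y + Suc n) a = triangle a" for a by (induction a) auto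
  ultimately show ?thesis by simp
qed

lemma recfun_prod_encode:
  "recfun k f \<Longrightarrow> recfun k g \<Longrightarrow> recfun k (\<lambda>xs. prod_encode (f xs, g xs))"
  unfolding prod_encode_def by (auto intro!: recfun_add recfun_triangle)

text \<open>The sum of the two components of \<open>z\<close> is the least \<open>s\<close> with \<open>z < triangle (Suc s)\<close>.\<close>

lemma recfun_prod_decode:
  assumes f: "recfun k f"
  shows "recfun k (\<lambda>xs. fst (prod_decode (f xs)))" "recfun k (\<lambda>xs. snd (prod_decode (f xs)))"
proof -
  define s where "s z = (LEAST s. Suc z - triangle (Suc s) = 0)" for z
  have mono: "triangle a \<le> triangle b" if "a \<le> b" for a b
    using that by (induction rule: dec_induct) auto
  have s: "s (prod_encode (a, b)) = a + b" for a b
    unfolding s_def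
  proof (rule Least_equality)
    show "Suc (prod_encode (a, b)) - triangle (Suc (a + b)) = 0" by (simp add: prod_encode_def)
    fix y assume y: "Suc (prod_encode (a, b)) - triangle (Suc y) = 0"
    show "a + b \<le> y"
    proof (rule ccontr)
      assume "\<not> a + b \<le> y"
      then have "triangle (Suc y) \<le> triangle (a + b)" by (intro mono) simp
      with y show False by (simp add: prod_encode_def)
    qed
  qed
  have ex: "\<exists>s. Suc z - triangle (Suc s) = 0" for z
  proof -
    have "z \<le> triangle z" by (induction z) auto
    then show ?thesis by (intro exI[of _ z]) auto
  qed
  have "recfun 1 (\<lambda>xs. LEAST n. Suc ((n # xs) ! 1) - triangle (Suc ((n # xs) ! 0)) = 0)"
    by (intro recfun_Least recfun_diff recfun_Suc recfun_triangle recfun_nth) (use ex in simp_all)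
  then have "recfun (length [f]) (\<lambda>xs. s (xs ! 0))" by (simp add: s_def)
  from recfun_comp[OF this, of k] f have sf: "recfun k (\<lambda>xs. s (f xs))" by simp
  \<comment> \<open>Since \<open>prod_encode (a, b) = triangle (a + b) + a\<close>, removing the
    triangle leaves the first component, and the rest of the sum is the second.\<close>
  have 1: "fst (prod_decode z) = z - triangle (s z)" for z
  proof -
    obtain a b where "z = prod_encode (a, b)" by (metis prod_decode_inverse surj_pair)
    then show ?thesis by (simp add: s) (simp add: prod_encode_def)
  qed
  have 2: "snd (prod_decode z) = s z - (z - triangle (s z))" for z
  proof -
    obtain a b where "z = prod_encode (a, b)" by (metis prod_decode_inverse surj_pair)
    then show ?thesis by (simp add: s) (simp add: prod_encode_def)
  qed
  show "recfun k (\<lambda>xs. fst (prod_decode (f xs)))" "recfun k (\<lambda>xs. snd (prod_decode (f xs)))"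
    unfolding 1 2 by (intro recfun_diff recfun_triangle f sf)+
qed


section \<open>Types with a bijective encoding\<close>

text \<open>
  Encodings are required to be bijective so that minimisation can run through all values of a type.
\<close>

class encodable =
  fixes enc :: "'a \<Rightarrow> nat"
  assumes bij_enc: "bij enc"

definition dec :: "nat \<Rightarrow> 'a :: encodable" where
  "dec = inv_into UNIV enc"

lemma enc_eq_iff [simp]: "enc x = enc y \<longleftrightarrow> x = y"
  using bij_enc by (metis bij_pointE)

lemma enc_dec [simp]: "enc (dec n :: 'a :: encodable) = n"
  by (simp add: dec_def bij_enc bij_is_surj surj_f_inv_f)

lemma dec_enc [simp]: "dec (enc x) = x"
  by (simp add: dec_def bij_enc bij_is_inj)

instantiation nat :: encodable
begin
definition enc_nat :: "nat \<Rightarrow> nat" where "enc_nat n = n"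
instance by standard (simp add: bij_def inj_def surj_def enc_nat_def)
end

instantiation int :: encodable
begin
definition enc_int :: "int \<Rightarrow> nat" where "enc_int = int_encode"
instance by standard (simp add: enc_int_def bij_int_encode)
end

instantiation prod :: (encodable, encodable) encodable
begin
definition enc_prod :: "'a \<times> 'b \<Rightarrow> nat" where
  "enc_prod p = prod_encode (enc (fst p), enc (snd p))"
instance
proof
  show "bij (enc :: 'a \<times> 'b \<Rightarrow> nat)"
    by (rule o_bij[where g = "\<lambda>z. (dec (fst (prod_decode z)), dec (snd (prod_decode z)))"])
      (auto simp: enc_prod_def fun_eq_iff)
qed
end

instantiation list :: (encodable) encodable
begin
definition enc_list :: "'a list \<Rightarrow> nat" where "enc_list xs = list_encode (map enc xs)"
instance
proof
  show "bij (enc :: 'a list \<Rightarrow> nat)"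
    by (rule o_bij[where g = "\<lambda>z. map (dec) (list_decode z)"])
      (auto simp: enc_list_def fun_eq_iff comp_def)
qed
end

lemma enc_Nil [simp]: "enc [] = 0"
  by (simp add: enc_list_def)

lemma enc_Cons [simp]: "enc (x # xs) = Suc (enc (x, xs))"
  by (simp add: enc_list_def enc_prod_def)

text \<open>Primitive recursion needs the number of steps in advance; the code of a list is a
  sufficient number for a recursion along the list.\<close>

lemma length_le_enc: "length xs \<le> enc xs"
proof (induction xs)
  case (Cons x xs)
  then show ?case
    using le_prod_encode_2[of "enc xs" "enc x"] by (simp add: enc_prod_def)
qed simp

section \<open>Computable functions between encodable types\<close>

text \<open>Programs are unary here: several arguments are passed as nested pairs, so that all
  closure rules have the same shape.\<close>

definition computable :: "('a :: encodable \<Rightarrow> 'b :: encodable) \<Rightarrow> bool" where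
  "computable f \<longleftrightarrow> (\<exists>P. \<forall>x. evals P [enc x] (enc (f x)))"

lemma computable_recfunI:
  assumes "recfun 1 g" "\<And>x. g [enc x] = enc (f x)"
  shows "computable f"
  proof -
  obtain P where "\<And>xs. length xs = 1 \<Longrightarrow> evals P xs (g xs)" using assms(1) by (auto simp: recfun_def)
  then have "evals P [enc x] (enc (f x))" for x using assms(2)[of x] by (metis One_nat_def length_Cons list.size(3))
  then show ?thesis unfolding computable_def by blast
qed

text \<open>Translates back to functions on codes. The second conjunct builds in composition, so
  that \<open>g\<close> may be applied to any subterm of an expression in the argument list.\<close>

lemma computable_recfunD:
  assumes "computable f"
  shows "\<exists>g. (\<forall>x. g (enc x) = enc (f x)) \<and> (\<forall>k a. recfun k a \<longrightarrow> recfun k (\<lambda>xs. g (a xs)))"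
proof (intro exI[of _ "\<lambda>z. enc (f (dec z))"] conjI allI impI)
  fix k a assume a: "recfun k a"
  obtain P where P: "\<And>x. evals P [enc x] (enc (f x))" using assms by (auto simp: computable_def)
  have "evals P xs (enc (f (dec (xs ! 0))))" if "length xs = 1" for xs
    using that P[of "dec (xs ! 0)"] by (cases xs) auto
  then have "recfun (length [a]) (\<lambda>xs. enc (f (dec (xs ! 0))))" by (auto simp: recfun_def)
  from recfun_comp[OF this, of k] a show "recfun k (\<lambda>xs. enc (f (dec (a xs))))" by simp
qed simp

named_theorems computable_intros

lemma recfun_const: "recfun k (\<lambda>xs. c)"
  by (induction c) (auto intro: recfun_zero recfun_Suc)

lemma computable_id [computable_intros]: "computable (\<lambda>x. x)"
  by (rule computable_recfunI[OF recfun_nth[of 0]]) auto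

lemma computable_const [computable_intros]: "computable (\<lambda>x. c)"
  by (rule computable_recfunI[OF recfun_const[of _ "enc c"]]) auto

lemma computable_comp:
  assumes "computable f" "computable g"
  shows "computable (\<lambda>x. f (g x))"
proof -
  obtain f' where f': "\<And>x. f' (enc x) = enc (f x)" "\<And>k a. recfun k a \<Longrightarrow> recfun k (\<lambda>xs. f' (a xs))"
    using computable_recfunD[OF assms(1)] by blast
  obtain g' where g': "\<And>x. g' (enc x) = enc (g x)" "\<And>k a. recfun k a \<Longrightarrow> recfun k (\<lambda>xs. g' (a xs))"
    using computable_recfunD[OF assms(2)] by blast
  have "recfun 1 (\<lambda>xs. f' (g' (xs ! 0)))" by (intro f' g' recfun_nth) simp
  then show ?thesis by (rule computable_recfunI) (simp add: f' g')
qed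

lemma computable_Pair [computable_intros]:
  assumes "computable f" "computable g"
  shows "computable (\<lambda>x. (f x, g x))"
proof -
  obtain f' where f': "\<And>x. f' (enc x) = enc (f x)" "\<And>k a. recfun k a \<Longrightarrow> recfun k (\<lambda>xs. f' (a xs))"
    using computable_recfunD[OF assms(1)] by blast
  obtain g' where g': "\<And>x. g' (enc x) = enc (g x)" "\<And>k a. recfun k a \<Longrightarrow> recfun k (\<lambda>xs. g' (a xs))"
    using computable_recfunD[OF assms(2)] by blast
  have "recfun 1 (\<lambda>xs. prod_encode (f' (xs ! 0), g' (xs ! 0)))"
    by (intro recfun_prod_encode f' g' recfun_nth) simp_all
  then show ?thesis by (rule computable_recfunI) (simp add: f' g' enc_prod_def)
qed

lemma computable_fst [computable_intros]: "computable f \<Longrightarrow> computable (\<lambda>x. fst (f x))"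
proof (rule computable_comp[of fst])
  have "recfun 1 (\<lambda>xs. fst (prod_decode (xs ! 0)))" by (intro recfun_prod_decode recfun_nth) simp
  then show "computable (fst :: 'b \<times> 'c \<Rightarrow> 'b)" by (rule computable_recfunI) (simp add: enc_prod_def)
qed

lemma computable_snd [computable_intros]: "computable f \<Longrightarrow> computable (\<lambda>x. snd (f x))"
proof (rule computable_comp[of snd])
  have "recfun 1 (\<lambda>xs. snd (prod_decode (xs ! 0)))" by (intro recfun_prod_decode recfun_nth) simp
  then show "computable (snd :: 'b \<times> 'c \<Rightarrow> 'c)" by (rule computable_recfunI) (simp add: enc_prod_def)
qed

lemma computable_enc [computable_intros]: "computable f \<Longrightarrow> computable (\<lambda>x. enc (f x))"
proof (rule computable_comp[of enc])
  show "computable (enc :: 'b \<Rightarrow> nat)"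
    by (rule computable_recfunI[OF recfun_nth[of 0]]) (auto simp: enc_nat_def)
qed

text \<open>The step function may depend on the parameter \<open>x\<close>. Its computability is
  stated for the triple \<open>(x, n, y)\<close>, read off by projections, because
  \<open>computable\<close> speaks of functions of one argument; the later rules with bound
  variables follow this pattern.\<close>

lemma computable_rec_nat [computable_intros]:
  assumes "computable m" "computable f" "computable (\<lambda>p. h (fst p) (fst (snd p)) (snd (snd p)))"
  shows "computable (\<lambda>x. rec_nat (f x) (\<lambda>n y. h x n y) (m x))"
proof -
  obtain f' where f': "\<And>x. f' (enc x) = enc (f x)" "\<And>k a. recfun k a \<Longrightarrow> recfun k (\<lambda>xs. f' (a xs))"
    using computable_recfunD[OF assms(2)] by blast
  obtain m' where m': "\<And>x. m' (enc x) = enc (m x)" "\<And>k a. recfun k a \<Longrightarrow> recfun k (\<lambda>xs. m' (a xs))"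
    using computable_recfunD[OF assms(1)] by blast
  obtain h' where h': "\<And>p. h' (enc p) = enc (h (fst p) (fst (snd p)) (snd (snd p)))"
    "\<And>k a. recfun k a \<Longrightarrow> recfun k (\<lambda>xs. h' (a xs))"
    using computable_recfunD[OF assms(3)] by blast
  have h'': "h' (prod_encode (enc x, prod_encode (n, enc y))) = enc (h x n y)" for x n y
    using h'(1)[of "(x, n, y)"] by (simp add: enc_prod_def enc_nat_def)
  have "recfun 1 (\<lambda>xs. rec_nat (f' (xs ! 0))
      (\<lambda>n y. h' (prod_encode ((n # y # xs) ! 2, prod_encode ((n # y # xs) ! 0, (n # y # xs) ! 1))))
      (m' (xs ! 0)))"
    by (intro recfun_rec_nat recfun_prod_encode f' m' h' recfun_nth) simp_all
  then show ?thesis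
  proof (rule computable_recfunI)
    fix x
    have "rec_nat (enc (f x)) (\<lambda>n y. h' (prod_encode (enc x, prod_encode (n, y)))) N =
        enc (rec_nat (f x) (\<lambda>n y. h x n y) N)" for N
      by (induction N) (auto simp: h'')
    then show "rec_nat (f' ([enc x] ! 0))
      (\<lambda>n y. h' (prod_encode ((n # y # [enc x]) ! 2,
        prod_encode ((n # y # [enc x]) ! 0, (n # y # [enc x]) ! 1)))) (m' ([enc x] ! 0)) =
        enc (rec_nat (f x) (\<lambda>n y. h x n y) (m x))"
      by (simp add: f' m' enc_nat_def)
  qed
qed

text \<open>The empty list has code 0 and any other list the successor of the code of its head and
  tail. A primitive recursion that ignores the previous value is therefore a case distinction: its
  last counter is the code of head and tail.\<close>

lemma computable_case_list [computable_intros]: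
  assumes "computable l" "computable f" "computable (\<lambda>p. h (fst p) (fst (snd p)) (snd (snd p)))"
  shows "computable (\<lambda>x. case l x of [] \<Rightarrow> f x | a # r \<Rightarrow> h x a r)"
proof -
  obtain f' where f': "\<And>x. f' (enc x) = enc (f x)" "\<And>k a. recfun k a \<Longrightarrow> recfun k (\<lambda>xs. f' (a xs))"
    using computable_recfunD[OF assms(2)] by blast
  obtain l' where l': "\<And>x. l' (enc x) = enc (l x)" "\<And>k a. recfun k a \<Longrightarrow> recfun k (\<lambda>xs. l' (a xs))"
    using computable_recfunD[OF assms(1)] by blast
  obtain h' where h': "\<And>p. h' (enc p) = enc (h (fst p) (fst (snd p)) (snd (snd p)))"
    "\<And>k a. recfun k a \<Longrightarrow> recfun k (\<lambda>xs. h' (a xs))"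
    using computable_recfunD[OF assms(3)] by blast
  have h'': "h' (prod_encode (enc x, enc (a, r))) = enc (h x a r)" for x a r
    using h'(1)[of "(x, a, r)"] by (simp add: enc_prod_def)
  have "recfun 1 (\<lambda>xs. rec_nat (f' (xs ! 0))
      (\<lambda>n y. h' (prod_encode ((n # y # xs) ! 2, (n # y # xs) ! 0))) (l' (xs ! 0)))"
    by (intro recfun_rec_nat recfun_prod_encode f' l' h' recfun_nth) simp_all
  then show ?thesis
    by (rule computable_recfunI) (auto simp: f' l' h'' split: list.split)
qed

lemma computable_Suc [computable_intros]: "computable f \<Longrightarrow> computable (\<lambda>x. Suc (f x))"
proof (rule computable_comp[of Suc])
  have "recfun 1 (\<lambda>xs. Suc (xs ! 0))" by (intro recfun_Suc recfun_nth) simp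
  then show "computable Suc" by (rule computable_recfunI) (simp add: enc_nat_def)
qed

lemma computable_Cons [computable_intros]:
  assumes "computable f" "computable g"
  shows "computable (\<lambda>x. f x # g x)"
proof -
  obtain h where h: "\<And>x. h (enc x) = enc (f x, g x)" "\<And>k a. recfun k a \<Longrightarrow> recfun k (\<lambda>xs. h (a xs))"
    using computable_recfunD[OF computable_Pair[OF assms]] by blast
  have "recfun 1 (\<lambda>xs. Suc (h (xs ! 0)))" by (intro recfun_Suc h recfun_nth) simp
  then show ?thesis by (rule computable_recfunI) (simp add: h)
qed

lemma computable_add_nat [computable_intros]:
  "computable f \<Longrightarrow> computable g \<Longrightarrow> computable (\<lambda>x. f x + g x :: nat)"
proof -
  assume fg: "computable f" "computable g"
  have "rec_nat b (\<lambda>n y. Suc y) a = a + b" for a b by (induction a) auto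
  moreover have "computable (\<lambda>x. rec_nat (g x) (\<lambda>n y. Suc y) (f x))"
    by (intro computable_intros fg)
  ultimately show ?thesis by simp
qed

lemma computable_diff_nat [computable_intros]:
  "computable f \<Longrightarrow> computable g \<Longrightarrow> computable (\<lambda>x. f x - g x :: nat)"
proof -
  assume fg: "computable f" "computable g"
  have "rec_nat a (\<lambda>n y. rec_nat 0 (\<lambda>m z. m) y) b = a - b" for a b :: nat
  proof (induction b)
    case (Suc b)
    then show ?case by (cases "a - b") auto
  qed simp
  moreover have "computable (\<lambda>x. rec_nat (f x) (\<lambda>n y. rec_nat 0 (\<lambda>m z. m) y) (g x) :: nat)"
    by (intro computable_intros fg)
  ultimately show ?thesis by simp
qed

lemma computable_mult_nat [computable_intros]:
  "computable f \<Longrightarrow> computable g \<Longrightarrow> computable (\<lambda>x. f x * g x :: nat)"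
proof -
  assume fg: "computable f" "computable g"
  have "rec_nat 0 (\<lambda>n y. y + b) a = a * b" for a b :: nat by (induction a) auto
  moreover have "computable (\<lambda>x. rec_nat 0 (\<lambda>n y. y + g x) (f x) :: nat)"
    by (intro computable_intros fg computable_comp[OF fg(2)])
  ultimately show ?thesis by simp
qed

section \<open>Decidable predicates\<close>

definition decidable :: "('a :: encodable \<Rightarrow> bool) \<Rightarrow> bool" where
  "decidable P \<longleftrightarrow> computable (\<lambda>x. of_bool (P x) :: nat)"

lemma computable_If [computable_intros]:
  assumes "decidable P" "computable f" "computable g"
  shows "computable (\<lambda>x. if P x then f x else g x)"
proof -
  have "computable (\<lambda>x. rec_nat (g x) (\<lambda>_ _. f x) (of_bool (P x)))"
    by (intro computable_rec_nat assms(1)[unfolded decidable_def] assms computable_comp[OF assms(2)]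
        computable_intros)
  moreover have "rec_nat (g x) (\<lambda>_ _. f x) (of_bool (P x)) = (if P x then f x else g x)" for x
    by simp
  ultimately show ?thesis by simp
qed

lemma decidable_not [computable_intros]: "decidable P \<Longrightarrow> decidable (\<lambda>x. \<not> P x)"
proof -
  assume P: "decidable P"
  have "computable (\<lambda>x. 1 - of_bool (P x) :: nat)"
    by (intro computable_intros P[unfolded decidable_def])
  moreover have "of_bool (\<not> P x) = (1 - of_bool (P x) :: nat)" for x by simp
  ultimately show ?thesis unfolding decidable_def by presburger
qed

lemma decidable_conj [computable_intros]:
  "decidable P \<Longrightarrow> decidable Q \<Longrightarrow> decidable (\<lambda>x. P x \<and> Q x)"
  unfolding decidable_def of_bool_conj by (intro computable_intros)

text \<open>\<open>enc\<close> is injective, and two codes agree exactly if both of their truncated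
  differences vanish.\<close>

lemma decidable_eq [computable_intros]:
  "computable f \<Longrightarrow> computable g \<Longrightarrow> decidable (\<lambda>x. f x = g x)"
proof -
  assume fg: "computable f" "computable g"
  have "computable (\<lambda>x. 1 - ((enc (f x) - enc (g x)) + (enc (g x) - enc (f x))))"
    by (intro computable_intros fg)
  moreover have "1 - ((enc (f x) - enc (g x)) + (enc (g x) - enc (f x))) = of_bool (f x = g x)" for x
    proof (cases "f x = g x")
    case False
    then have "enc (f x) \<noteq> enc (g x)" by simp
    with False show ?thesis by (simp del: enc_eq_iff)
  qed simp
  ultimately show ?thesis by (simp add: decidable_def)
qed

lemma decidable_le_nat [computable_intros]:
  "computable f \<Longrightarrow> computable g \<Longrightarrow> decidable (\<lambda>x. f x \<le> (g x :: nat))"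
proof -
  assume fg: "computable f" "computable g"
  have "decidable (\<lambda>x. f x - g x = 0)" by (intro computable_intros fg)
  then show ?thesis by simp
qed

section \<open>Functions on lists\<close>

text \<open>The state of the recursion is the unread part of the list together with the accumulator.
  It is iterated as often as the code of the list says, which is at least its length; surplus steps
  leave the state unchanged.\<close>

lemma computable_fold [computable_intros]:
  assumes l: "computable l" and i: "computable i"
    and h: "computable (\<lambda>p. h (fst p) (fst (snd p)) (snd (snd p)))"
  shows "computable (\<lambda>x. fold (\<lambda>a s. h x a s) (l x) (i x))"
proof -
  define step where "step x s = (case fst s of [] \<Rightarrow> s | a # r \<Rightarrow> (r, h x a (snd s)))" for x s
  have "computable (\<lambda>x. snd (rec_nat (l x, i x)
      (\<lambda>_ s. case fst s of [] \<Rightarrow> s | a # r \<Rightarrow> (r, h x a (snd s))) (enc (l x))))"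
    by (intro computable_intros l i
        computable_comp[OF h, of "\<lambda>p. (fst (fst p), fst (snd p), snd (snd (snd (fst p))))", simplified])
  moreover have "rec_nat (xs, s) (\<lambda>_ s. step x s) N = ([], fold (h x) xs s)"
    if "length xs \<le> N" for x xs s N
  proof -
    have *: "rec_nat q (\<lambda>_ s. step x s) n = (step x ^^ n) q" for q n by (induction n) auto
    show ?thesis using that unfolding *
    proof (induction xs arbitrary: s N)
      case Nil
      show ?case by (induction N) (auto simp: step_def)
    next
      case (Cons a xs)
      then obtain M where "N = Suc M" "length xs \<le> M" by (cases N) auto
      with Cons.IH[of M "h x a s"] show ?case by (simp add: step_def funpow_Suc_right del: funpow.simps)
    qed
  qed
  from this[OF length_le_enc]
  have "rec_nat (l x, i x) (\<lambda>_ s. case fst s of [] \<Rightarrow> s | a # r \<Rightarrow> (r, h x a (snd s))) (enc (l x)) =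
      ([], fold (h x) (l x) (i x))" for x
    by (simp add: step_def[abs_def])
  ultimately show ?thesis by simp
qed

lemma computable_foldr [computable_intros]:
  assumes l: "computable l" and i: "computable i"
    and h: "computable (\<lambda>p. h (fst p) (fst (snd p)) (snd (snd p)))"
  shows "computable (\<lambda>x. foldr (\<lambda>a s. h x a s) (l x) (i x))"
proof -
  have "computable (\<lambda>x. fold (\<lambda>a s. a # s) (l x) [])" by (intro computable_intros l)
  moreover have "fold (\<lambda>a s. a # s) xs [] = rev xs" for xs :: "'b list" by (simp add: fold_Cons_rev)
  ultimately have "computable (\<lambda>x. rev (l x))" by simp
  from computable_fold[OF this i h] show ?thesis by (simp add: foldr_conv_fold)
qed

lemma computable_map [computable_intros]:
  assumes "computable l" "computable (\<lambda>p. f (fst p) (snd p))"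
  shows "computable (\<lambda>x. map (\<lambda>a. f x a) (l x))"
proof -
  have "computable (\<lambda>x. foldr (\<lambda>a s. f x a # s) (l x) [])"
    by (intro computable_intros assms(1)
        computable_comp[OF assms(2), of "\<lambda>p. (fst p, fst (snd p))", simplified])
  moreover have "foldr (\<lambda>a s. f x a # s) xs [] = map (f x) xs" for x xs by (induction xs) auto
  ultimately show ?thesis by simp
qed

lemma computable_append [computable_intros]:
  assumes "computable f" "computable g"
  shows "computable (\<lambda>x. f x @ g x)"
proof -
  have "computable (\<lambda>x. foldr (\<lambda>a s. a # s) (f x) (g x))" by (intro computable_intros assms)
  moreover have "foldr (\<lambda>a s. a # s) xs ys = xs @ ys" for xs ys :: "'b list" by (induction xs) auto
  ultimately show ?thesis by simp
qed

lemma computable_concat [computable_intros]: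
  assumes "computable f"
  shows "computable (\<lambda>x. concat (f x))"
proof -
  have "computable (\<lambda>x. foldr (\<lambda>a s. a @ s) (f x) [])" by (intro computable_intros assms)
  moreover have "foldr (\<lambda>a s. a @ s) xs [] = concat xs" for xs :: "'b list list" by (induction xs) auto
  ultimately show ?thesis by simp
qed

lemma computable_length [computable_intros]:
  assumes "computable f"
  shows "computable (\<lambda>x. length (f x))"
proof -
  have "computable (\<lambda>x. foldr (\<lambda>a s. Suc s) (f x) 0)" by (intro computable_intros assms)
  moreover have "foldr (\<lambda>a s. Suc s) xs 0 = length xs" for xs :: "'b list" by (induction xs) auto
  ultimately show ?thesis by simp
qed

lemma computable_upt [computable_intros]:
  assumes "computable f"
  shows "computable (\<lambda>x. [0..<f x])"
proof -
  have "computable (\<lambda>x. rec_nat [] (\<lambda>n s. s @ [n]) (f x))" by (intro computable_intros assms)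
  moreover have "rec_nat [] (\<lambda>n s. s @ [n]) m = [0..<m]" for m by (induction m) auto
  ultimately show ?thesis by simp
qed

lemma computable_replicate [computable_intros]:
  assumes "computable f" "computable g"
  shows "computable (\<lambda>x. replicate (f x) (g x))"
proof -
  have "computable (\<lambda>x. map (\<lambda>_. g x) [0..<f x])"
    by (intro computable_intros assms computable_comp[OF assms(2)])
  then show ?thesis by (simp add: map_replicate_const)
qed

lemma computable_nth_default [computable_intros]:
  assumes "computable d" "computable f" "computable i"
  shows "computable (\<lambda>x. nth_default (d x) (f x) (i x))"
proof -
  have "computable (\<lambda>x. case rec_nat (f x) (\<lambda>_ r. case r of [] \<Rightarrow> [] | a # r' \<Rightarrow> r') (i x) of
      [] \<Rightarrow> d x | a # r \<Rightarrow> a)"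
    by (intro computable_intros assms)
  moreover have "rec_nat xs (\<lambda>_ r. case r of [] \<Rightarrow> [] | a # r' \<Rightarrow> r') n = drop n xs" for xs :: "'b list" and n
  proof (induction n)
    case (Suc n)
    moreover have "drop (Suc n) xs = tl (drop n xs)" by (simp add: drop_Suc tl_drop)
    ultimately show ?case by (cases "drop n xs") auto
  qed simp
  moreover have "(case drop n xs of [] \<Rightarrow> y | a # r \<Rightarrow> a) = nth_default y xs n" for y :: 'b and xs n
    by (induction xs arbitrary: n) (auto split: nat.split simp: drop_Cons)
  ultimately show ?thesis by simp
qed

lemma decidable_Ball [computable_intros]:
  assumes "computable l" "decidable (\<lambda>p. P (fst p) (snd p))"
  shows "decidable (\<lambda>x. \<forall>a\<in>set (l x). P x a)"
proof -
  have "computable (\<lambda>x. foldr (\<lambda>a s. of_bool (P x a) * s) (l x) 1 :: nat)"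
    by (intro computable_intros assms(1)
        computable_comp[OF assms(2)[unfolded decidable_def], of "\<lambda>p. (fst p, fst (snd p))", simplified])
  moreover have "foldr (\<lambda>a s. of_bool (P x a) * s) xs (1 :: nat) = of_bool (\<forall>a\<in>set xs. P x a)" for x xs
    by (induction xs) auto
  ultimately show ?thesis by (simp add: decidable_def)
qed

lemma decidable_Bex [computable_intros]:
  assumes "computable l" "decidable (\<lambda>p. P (fst p) (snd p))"
  shows "decidable (\<lambda>x. \<exists>a\<in>set (l x). P x a)"
proof -
  have "decidable (\<lambda>x. \<not> (\<forall>a\<in>set (l x). \<not> P x a))" by (intro computable_intros assms)
  then show ?thesis by simp
qed

text \<open>Serves for values that are easiest to describe by their codes, such as differences in
  \<open>int\<close>.\<close>

lemma computable_of_enc: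
  assumes "computable g" "\<And>x. enc (f x) = g x"
  shows "computable f"
proof -
  obtain P where "\<And>x. evals P [enc x] (enc (g x))" using assms(1) by (auto simp: computable_def)
  then have "evals P [enc x] (enc (f x))" for x by (metis assms(2) enc_nat_def)
  then show ?thesis by (auto simp: computable_def)
qed

section \<open>Integer arithmetic\<close>

text \<open>\<open>int_encode\<close> gives even codes to the nonnegative integers and odd codes to
  the negative ones, so halving and parity recover sign and absolute value. Both are counted up
  together.\<close>

lemma computable_div_mod_2:
  assumes "computable f"
  shows "computable (\<lambda>x. f x div 2 :: nat)" "computable (\<lambda>x. f x mod 2 :: nat)"
proof -
  have "computable (\<lambda>x. rec_nat (0, 0) (\<lambda>_ s. if snd s = 0 then (fst s, 1) else (fst s + 1, 0)) (f x)
      :: nat \<times> nat)"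
    by (intro computable_intros assms)
  moreover have "rec_nat (0, 0) (\<lambda>_ s. if snd s = 0 then (fst s, 1) else (fst s + 1, 0)) m =
      (m div 2, m mod 2)" for m :: nat
    by (induction m) (auto, presburger+)
  ultimately have *: "computable (\<lambda>x. (f x div 2, f x mod 2))" by simp
  show "computable (\<lambda>x. f x div 2)" "computable (\<lambda>x. f x mod 2)"
    using computable_fst[OF *] computable_snd[OF *] by simp_all
qed

text \<open>These are the positive and negative parts of an integer. Sums and products of integers
  are computed below as differences of natural numbers built from such parts.\<close>

lemma computable_nat [computable_intros]:
  assumes "computable f"
  shows "computable (\<lambda>x. nat (f x))" and computable_nat_uminus: "computable (\<lambda>x. nat (- f x))"
proof -
  have "computable (\<lambda>x. if enc (f x) mod 2 = 0 then enc (f x) div 2 else 0)"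
    by (intro computable_intros computable_div_mod_2 assms)
  moreover have "(if enc i mod 2 = 0 then enc i div 2 else 0) = nat i" for i :: int
    by (auto simp: enc_int_def int_encode_def sum_encode_def)
  ultimately show "computable (\<lambda>x. nat (f x))" by simp
  have "computable (\<lambda>x. if enc (f x) mod 2 = 0 then 0 else Suc (enc (f x) div 2))"
    by (intro computable_intros computable_div_mod_2 assms)
  moreover have "(if enc i mod 2 = 0 then 0 else Suc (enc i div 2)) = nat (- i)" for i :: int
    by (auto simp: enc_int_def int_encode_def sum_encode_def)
  ultimately show "computable (\<lambda>x. nat (- f x))" by simp
qed

lemma computable_int_diff:
  assumes "computable f" "computable g"
  shows "computable (\<lambda>x. int (f x) - int (g x))"
proof (rule computable_of_enc)
  show "computable (\<lambda>x. if g x \<le> f x then 2 * (f x - g x) else Suc (2 * (g x - f x - 1)))"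
    by (intro computable_intros assms)
  show "enc (int (f x) - int (g x)) = (if g x \<le> f x then 2 * (f x - g x) else Suc (2 * (g x - f x - 1)))" for x
    by (auto simp: enc_int_def int_encode_def sum_encode_def nat_diff_distrib)
qed

lemma computable_int [computable_intros]: "computable f \<Longrightarrow> computable (\<lambda>x. int (f x))"
  using computable_int_diff[OF _ computable_const[of 0]] by simp

lemma computable_add_int [computable_intros]:
  assumes "computable f" "computable g"
  shows "computable (\<lambda>x. f x + g x :: int)"
proof -
  have "computable (\<lambda>x. int (nat (f x) + nat (g x)) - int (nat (- f x) + nat (- g x)))"
    by (intro computable_int_diff computable_intros computable_nat_uminus assms)
  moreover have "int (nat i + nat j) - int (nat (- i) + nat (- j)) = i + j" for i j by simp
  ultimately show ?thesis by simp
qed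

lemma computable_mult_int [computable_intros]:
  assumes "computable f" "computable g"
  shows "computable (\<lambda>x. f x * g x :: int)"
proof -
  have "computable (\<lambda>x. int (nat (f x) * nat (g x) + nat (- f x) * nat (- g x)) -
      int (nat (f x) * nat (- g x) + nat (- f x) * nat (g x)))"
    by (intro computable_int_diff computable_intros computable_nat_uminus assms)
  moreover have "int (nat i * nat j + nat (- i) * nat (- j)) -
      int (nat i * nat (- j) + nat (- i) * nat j) = i * j" for i j
    by (cases "0 \<le> i"; cases "0 \<le> j") auto
  ultimately show ?thesis by simp
qed

text \<open>For curried constants: the definition has to be analysed only at the projections of a
  pair, and arbitrary computable arguments are substituted afterwards.\<close>

lemma computable_comp2:
  assumes "computable (\<lambda>p. h (fst p) (snd p))" "computable f" "computable g"
  shows "computable (\<lambda>x. h (f x) (g x))"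
  using computable_comp[OF assms(1) computable_Pair[OF assms(2,3)]] by simp

lemma computable_comp3:
  assumes "computable (\<lambda>p. h (fst p) (fst (snd p)) (snd (snd p)))"
    "computable f" "computable g" "computable k"
  shows "computable (\<lambda>x. h (f x) (g x) (k x))"
  using computable_comp[OF assms(1) computable_Pair[OF assms(2) computable_Pair[OF assms(3,4)]]] by simp

lemma decidable_comp:
  assumes "decidable P" "computable f"
  shows "decidable (\<lambda>x. P (f x))"
  using computable_comp[OF assms(1)[unfolded decidable_def] assms(2)] by (simp add: decidable_def)

text \<open>Unbounded search: minimise over the codes of witnesses, then evaluate \<open>f\<close>
  at the witness found. Every number is the code of a candidate, and since \<open>Q\<close> is
  decidable each failed candidate is rejected by a halting computation. Nothing is claimed for
  inputs without a witness.\<close>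

theorem computable_search:
  assumes Q: "decidable Q" and f: "computable f"
  shows "\<exists>A. \<forall>x. (\<exists>w. Q (x, w)) \<longrightarrow> (\<exists>w. Q (x, w) \<and> evals A [enc x] (enc (f (x, w))))"
proof -
  obtain q where q: "\<And>p. q (enc p) = enc (of_bool (\<not> Q p) :: nat)"
    "\<And>k a. recfun k a \<Longrightarrow> recfun k (\<lambda>xs. q (a xs))"
    using computable_recfunD[OF decidable_not[OF Q, unfolded decidable_def]] by blast
  \<comment> \<open>\<open>MuF\<close> searches over the first argument, so the candidate comes
    before the input here, while \<open>Q\<close> takes them in the opposite order.\<close>
  have "recfun 2 (\<lambda>xs. q (prod_encode (xs ! 1, xs ! 0)))"
    by (intro q recfun_prod_encode recfun_nth) simp_all
  then obtain C where C: "\<And>xs. length xs = 2 \<Longrightarrow> evals C xs (q (prod_encode (xs ! 1, xs ! 0)))"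
    by (auto simp: recfun_def)
  obtain f' where f': "\<And>p. f' (enc p) = enc (f p)" "\<And>k a. recfun k a \<Longrightarrow> recfun k (\<lambda>xs. f' (a xs))"
    using computable_recfunD[OF f] by blast
  have "recfun 2 (\<lambda>xs. f' (prod_encode (xs ! 0, xs ! 1)))"
    by (intro f' recfun_prod_encode recfun_nth) simp_all
  then obtain P where P: "\<And>xs. length xs = 2 \<Longrightarrow> evals P xs (f' (prod_encode (xs ! 0, xs ! 1)))"
    by (auto simp: recfun_def)
  have C': "evals C [enc w, enc x] (of_bool (\<not> Q (x, w)))" for x w
    using C[of "[enc w, enc x]"] q(1)[of "(x, w)"] by (simp add: enc_prod_def enc_nat_def)
  have P': "evals P [enc x, enc w] (enc (f (x, w)))" for x w
    using P[of "[enc x, enc w]"] f'(1)[of "(x, w)"] by (simp add: enc_prod_def)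
  \<comment> \<open>\<open>ProjF 0\<close> passes on the input and \<open>MuF C\<close> supplies the
    least code of a witness.\<close>
  let ?A = "CompF P [ProjF 0, MuF C]"
  have "\<exists>w. Q (x, w) \<and> evals ?A [enc x] (enc (f (x, w)))" if ex: "\<exists>w. Q (x, w)" for x
  proof -
    define m where "m = (LEAST m. Q (x, dec m))"
    have "\<exists>m. Q (x, dec m)" using ex by (metis dec_enc)
    from LeastI_ex[OF this] have m: "Q (x, dec m)" by (simp add: m_def)
    have "evals (MuF C) [enc x] m"
    proof (rule evals_Mu)
      show "evals C [m, enc x] 0" using C'[of "dec m" x] m by simp
      show "\<forall>i<m. \<exists>y>0. evals C [i, enc x] y"
      proof (intro allI impI exI conjI)
        fix i assume "i < m"
        then have "\<not> Q (x, dec i)" using not_less_Least by (auto simp: m_def)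
        then show "evals C [i, enc x] 1" using C'[of "dec i" x] by simp
      qed simp
    qed
    then have "evals ?A [enc x] (enc (f (x, dec m)))"
      using P'[of x "dec m"] evals_Proj[of 0 "[enc x]"]
      by (intro evals_Comp[where ys = "[enc x, m]"]) (auto simp: less_Suc_eq)
    with m show ?thesis by blast
  qed
  then show ?thesis by blast
qed


section \<open>Ascending chains of ideals\<close>

text \<open>Every sequence has a monotone subsequence, and a decreasing one in the natural numbers
  is constant from the point where it attains its minimum.\<close>

lemma mono_subseq_nat:
  fixes s :: "nat \<Rightarrow> nat"
  shows "\<exists>r :: nat \<Rightarrow> nat. strict_mono r \<and> mono (\<lambda>i. s (r i))"
proof -
  obtain f :: "nat \<Rightarrow> nat" where f: "strict_mono f" "monoseq (\<lambda>n. s (f n))"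
    using seq_monosub[of s] by blast
  show ?thesis
  proof (cases "mono (\<lambda>n. s (f n))")
    case True
    then show ?thesis using f by blast
  next
    case False
    then have dec: "\<And>i j. i \<le> j \<Longrightarrow> s (f j) \<le> s (f i)"
      using f(2) by (auto simp: monoseq_def mono_def)
    define N where "N = (ARG_MIN (\<lambda>n. s (f n)) n. True)"
    have min: "s (f N) \<le> s (f n)" for n
      unfolding N_def by (rule arg_min_nat_le) simp
    have "s (f (N + i)) = s (f N)" for i
      using dec[of N "N + i"] min[of "N + i"] by simp
    then have "mono (\<lambda>i. s ((\<lambda>i. f (N + i)) i))" by (simp add: mono_def)
    moreover have "strict_mono (\<lambda>i. f (N + i))"
      using f(1) by (simp add: strict_mono_def)
    ultimately show ?thesis by blast
  qed
qed

text \<open>The subsequence is thinned out for one coordinate after another; passing to a further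
  subsequence keeps the earlier coordinates monotone.\<close>

lemma mono_subseq_coordinates:
  fixes s :: "nat \<Rightarrow> nat \<Rightarrow> nat"
  shows "\<exists>r :: nat \<Rightarrow> nat. strict_mono r \<and> (\<forall>k<n. mono (\<lambda>i. s (r i) k))"
proof (induction n)
  case 0
  show ?case by (intro exI[of _ id]) (simp add: strict_mono_def)
next
  case (Suc n)
  then obtain r :: "nat \<Rightarrow> nat" where r: "strict_mono r" "\<And>k. k < n \<Longrightarrow> mono (\<lambda>i. s (r i) k)" by blast
  obtain r' :: "nat \<Rightarrow> nat" where r': "strict_mono r'" "mono (\<lambda>i. s (r (r' i)) n)"
    using mono_subseq_nat[of "\<lambda>i. s (r i) n"] by blast
  have "strict_mono (\<lambda>i. r (r' i))" using r(1) r'(1) by (simp add: strict_mono_def)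
  moreover have "mono (\<lambda>i. s (r (r' i)) k)" if "k < Suc n" for k
  proof (cases "k = n")
    case False
    then have "mono (\<lambda>i. s (r i) k)" using r(2) that by simp
    then show ?thesis using strict_mono_mono[OF r'(1)] by (auto simp: mono_def)
  qed (use r' in simp)
  ultimately show ?case by blast
qed

text \<open>The first two members of a subsequence that increases in each of the \<open>n\<close>
  coordinates are comparable, and their truncated difference is the quotient. All other coordinates
  vanish.\<close>

lemma dickson:
  fixes s :: "nat \<Rightarrow> (nat \<Rightarrow>\<^sub>0 nat)"
  assumes "\<And>i. Poly_Mapping.keys (s i) \<subseteq> {..<n}"
  shows "\<exists>i j d. i < j \<and> s j = s i + d"
proof -
  obtain r :: "nat \<Rightarrow> nat" where r: "strict_mono r" "\<And>k. k < n \<Longrightarrow> mono (\<lambda>i. Poly_Mapping.lookup (s (r i)) k)"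
    using mono_subseq_coordinates[of n "\<lambda>i. Poly_Mapping.lookup (s i)"] by blast
  have "Poly_Mapping.lookup (s (r 0)) k \<le> Poly_Mapping.lookup (s (r 1)) k" for k
  proof (cases "k < n")
    case True
    then show ?thesis using r(2) by (auto simp: mono_def)
  next
    case False
    then have "k \<notin> Poly_Mapping.keys (s (r 0))" using assms by blast
    then show ?thesis by (simp add: in_keys_iff)
  qed
  then have "s (r 1) = s (r 0) + (s (r 1) - s (r 0))"
    by (intro poly_mapping_eqI) (simp add: lookup_add lookup_minus)
  moreover have "r 0 < r 1" using r(1) by (simp add: strict_mono_def)
  ultimately show ?thesis by blast
qed

section \<open>The lexicographic order on monomials\<close>

text \<open>Monomials are ordered by their exponents at the least index where they differ; for 0 and
  \<open>m\<close> this is the least index in the support of \<open>m\<close>.\<close>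

lemma zero_le_monomial: "0 \<le> (m :: nat \<Rightarrow>\<^sub>0 nat)"
proof (cases "m = 0")
  case False
  define k where "k = (LEAST k. Poly_Mapping.lookup m k \<noteq> 0)"
  have "\<exists>k. Poly_Mapping.lookup m k \<noteq> 0" using False by (metis lookup_zero poly_mapping_eqI)
  from LeastI_ex[OF this] have k: "Poly_Mapping.lookup m k \<noteq> 0" by (simp add: k_def)
  have "Poly_Mapping.lookup m k' = 0" if "k' < k" for k'
    using not_less_Least[of k' "\<lambda>k. Poly_Mapping.lookup m k \<noteq> 0"] that by (auto simp: k_def)
  then have "less_fun (Poly_Mapping.lookup 0) (Poly_Mapping.lookup m)"
    using k by (auto simp: less_fun_def)
  then have "0 < m" by (simp add: less_poly_mapping.rep_eq)
  then show ?thesis by simp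
qed simp

text \<open>In an infinite descending chain Dickson's lemma would find an earlier member dividing a
  later one, hence not exceeding it. The bound on the indeterminates matters: without it they form a
  descending chain themselves.\<close>

lemma ex_min_monomial:
  assumes "M \<noteq> {}" "\<And>m. m \<in> M \<Longrightarrow> Poly_Mapping.keys m \<subseteq> {..<n}"
  shows "\<exists>m\<in>M. \<forall>m'\<in>M. m \<le> (m' :: nat \<Rightarrow>\<^sub>0 nat)"
proof (rule ccontr)
  assume "\<not> ?thesis"
  then have "\<forall>m\<in>M. \<exists>m'\<in>M. m' < m" by (meson not_le)
  moreover obtain m0 where "m0 \<in> M" using assms(1) by blast
  ultimately obtain s where s: "\<And>i. s i \<in> M" "\<And>i. s (Suc i) < s i"
    using dependent_nat_choice[of "\<lambda>_ m. m \<in> M" "\<lambda>_ m m'. m' < m"] by blast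
  have dec: "s j < s i" if "i < j" for i j
    using that by (induction rule: strict_inc_induct) (auto intro: s less_trans)
  obtain i j d where "i < j" "s j = s i + d" using dickson[of s n] s(1) assms(2) by blast
  moreover have "s i \<le> s i + d" using add_left_mono[OF zero_le_monomial[of d], of "s i"] by simp
  ultimately show False using dec[of i j] by auto
qed

section \<open>Polynomials in n indeterminates and their ideals\<close>

lemma poly_mapping_sum_single:
  "(\<Sum>m\<in>Poly_Mapping.keys p. Poly_Mapping.single m (Poly_Mapping.lookup p m)) = p"
  by (intro poly_mapping_eqI) (simp add: lookup_sum lookup_single when_def in_keys_iff)

text \<open>By cancellation, adding \<open>d\<close> is injective on monomials, so a single term of
  the product contributes to this coefficient.\<close>

lemma lookup_single_times:
  fixes p :: "'a :: cancel_comm_monoid_add \<Rightarrow>\<^sub>0 'b :: semiring_0"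
  shows "Poly_Mapping.lookup (Poly_Mapping.single d c * p) (d + m) = c * Poly_Mapping.lookup p m"
proof -
  have "Poly_Mapping.single d c * p =
      (\<Sum>k\<in>Poly_Mapping.keys p. Poly_Mapping.single (d + k) (c * Poly_Mapping.lookup p k))"
    by (subst poly_mapping_sum_single[symmetric, of p]) (simp add: sum_distrib_left mult_single)
  then show ?thesis by (simp add: lookup_sum lookup_single when_def in_keys_iff)
qed

lemma qpolys_zero [simp]: "0 \<in> qpolys n"
  by (simp add: qpolys_def)

lemma qpolys_one [simp]: "1 \<in> qpolys n"
  by (simp add: qpolys_def)

lemma qpolys_single: "Poly_Mapping.keys m \<subseteq> {..<n} \<Longrightarrow> Poly_Mapping.single m c \<in> qpolys n"
  by (simp add: qpolys_def)

lemma qpolys_add: "p \<in> qpolys n \<Longrightarrow> q \<in> qpolys n \<Longrightarrow> p + q \<in> qpolys n"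
  using Poly_Mapping.keys_add[of p q] by (fastforce simp: qpolys_def)

lemma qpolys_mult: "p \<in> qpolys n \<Longrightarrow> q \<in> qpolys n \<Longrightarrow> p * q \<in> qpolys n"
  unfolding qpolys_def
proof clarify
  fix m i assume p: "\<forall>m\<in>Poly_Mapping.keys p. Poly_Mapping.keys m \<subseteq> {..<n}"
    and q: "\<forall>m\<in>Poly_Mapping.keys q. Poly_Mapping.keys m \<subseteq> {..<n}"
    and m: "m \<in> Poly_Mapping.keys (p * q)" and i: "i \<in> Poly_Mapping.keys m"
  obtain a b where ab: "m = a + b" "a \<in> Poly_Mapping.keys p" "b \<in> Poly_Mapping.keys q"
    using m Poly_Mapping.keys_mult[of p q] by blast
  then have "i \<in> Poly_Mapping.keys a \<union> Poly_Mapping.keys b"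
    using i Poly_Mapping.keys_add[of a b] by blast
  then show "i < n" using ab p q by blast
qed

lemma qpolys_sum_list: "set ps \<subseteq> qpolys n \<Longrightarrow> sum_list ps \<in> qpolys n"
  by (induction ps) (auto simp: qpolys_add)

text \<open>Membership is witnessed by a finite list of cofactors and generators, which is the shape
  that the certificates of the algorithm have.\<close>

definition ideal_gen :: "nat \<Rightarrow> qpoly set \<Rightarrow> qpoly set" where
  "ideal_gen n H = {p. \<exists>L. set L \<subseteq> qpolys n \<times> H \<and> p = (\<Sum>(q, h)\<leftarrow>L. q * h)}"

lemma ideal_gen_mono: "H \<subseteq> H' \<Longrightarrow> ideal_gen n H \<subseteq> ideal_gen n H'"
proof
  fix p assume H: "H \<subseteq> H'" and "p \<in> ideal_gen n H"
  then obtain L where L: "set L \<subseteq> qpolys n \<times> H" "p = (\<Sum>(q, h)\<leftarrow>L. q * h)"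
    by (auto simp: ideal_gen_def)
  from L(1) H have "set L \<subseteq> qpolys n \<times> H'" by blast
  with L(2) show "p \<in> ideal_gen n H'" unfolding ideal_gen_def by blast
qed

lemma ideal_gen_base: "h \<in> H \<Longrightarrow> h \<in> ideal_gen n H"
  unfolding ideal_gen_def by (auto intro!: exI[of _ "[(1, h)]"])

lemma ideal_gen_add:
  assumes "p \<in> ideal_gen n H" "p' \<in> ideal_gen n H"
  shows "p + p' \<in> ideal_gen n H"
proof -
  obtain L L' where "set L \<subseteq> qpolys n \<times> H" "p = (\<Sum>(q, h)\<leftarrow>L. q * h)"
    "set L' \<subseteq> qpolys n \<times> H" "p' = (\<Sum>(q, h)\<leftarrow>L'. q * h)"
    using assms by (auto simp: ideal_gen_def)
  then show ?thesis unfolding ideal_gen_def by (auto intro!: exI[of _ "L @ L'"])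
qed

lemma ideal_gen_mult:
  assumes "p \<in> ideal_gen n H" "r \<in> qpolys n"
  shows "r * p \<in> ideal_gen n H"
proof -
  obtain L where L: "set L \<subseteq> qpolys n \<times> H" "p = (\<Sum>(q, h)\<leftarrow>L. q * h)"
    using assms by (auto simp: ideal_gen_def)
  have "r * (\<Sum>(q, h)\<leftarrow>L. q * h) = (\<Sum>(q, h)\<leftarrow>map (\<lambda>(q, h). (r * q, h)) L. q * h)"
    by (induction L) (auto simp: algebra_simps)
  moreover have "set (map (\<lambda>(q, h). (r * q, h)) L) \<subseteq> qpolys n \<times> H"
    using L(1) assms(2) by (auto simp: qpolys_mult)
  ultimately show ?thesis unfolding ideal_gen_def using L(2) by blast
qed

lemma ideal_gen_subset_qpolys: "H \<subseteq> qpolys n \<Longrightarrow> ideal_gen n H \<subseteq> qpolys n"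
proof
  fix p assume H: "H \<subseteq> qpolys n" and "p \<in> ideal_gen n H"
  then obtain L where L: "set L \<subseteq> qpolys n \<times> H" "p = (\<Sum>(q, h)\<leftarrow>L. q * h)"
    by (auto simp: ideal_gen_def)
  from L(1) H have "set (map (\<lambda>(q, h). q * h) L) \<subseteq> qpolys n"
    using qpolys_mult by auto blast
  with L(2) show "p \<in> qpolys n" using qpolys_sum_list by blast
qed

section \<open>Leading monomials and stabilisation of chains\<close>

definition lead_monomial :: "qpoly \<Rightarrow> (nat \<Rightarrow>\<^sub>0 nat)" where
  "lead_monomial p = Max (Poly_Mapping.keys p)"

lemma lead_monomial_in_keys: "p \<noteq> 0 \<Longrightarrow> lead_monomial p \<in> Poly_Mapping.keys p"
  unfolding lead_monomial_def by (intro Max_in) simp_all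

lemma keys_le_lead_monomial: "m \<in> Poly_Mapping.keys p \<Longrightarrow> m \<le> lead_monomial p"
  unfolding lead_monomial_def by (intro Max_ge) simp_all

text \<open>The multiple of \<open>g\<close> is chosen to cancel the leading term of
  \<open>f\<close>. Since the order is compatible with addition, no other monomial of that multiple
  reaches the leading monomial either.\<close>

lemma lead_reduction:
  assumes "f \<noteq> 0" "g \<noteq> 0" "lead_monomial f = lead_monomial g + d"
  obtains c where "\<And>m. m \<in> Poly_Mapping.keys (f + Poly_Mapping.single d c * g) \<Longrightarrow> m < lead_monomial f"
proof
  define c where "c = - Poly_Mapping.lookup f (lead_monomial f) / Poly_Mapping.lookup g (lead_monomial g)"
  fix m assume m: "m \<in> Poly_Mapping.keys (f + Poly_Mapping.single d c * g)"
  have "Poly_Mapping.lookup g (lead_monomial g) \<noteq> 0"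
    using lead_monomial_in_keys[OF assms(2)] by (simp add: in_keys_iff)
  then have "Poly_Mapping.lookup (f + Poly_Mapping.single d c * g) (lead_monomial f) = 0"
    using lookup_single_times[of d c g "lead_monomial g"]
    by (simp add: lookup_add assms(3) add.commute c_def)
  with m have ne: "m \<noteq> lead_monomial f" by (auto simp: in_keys_iff)
  have "m \<le> lead_monomial f"
  proof (cases "m \<in> Poly_Mapping.keys f")
    case False
    then have "m \<in> Poly_Mapping.keys (Poly_Mapping.single d c * g)"
      using m Poly_Mapping.keys_add[of f "Poly_Mapping.single d c * g"] by blast
    then obtain a k where "m = a + k" "a \<in> Poly_Mapping.keys (Poly_Mapping.single d c)"
      and k: "k \<in> Poly_Mapping.keys g"
      using Poly_Mapping.keys_mult[of "Poly_Mapping.single d c" g] by blast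
    then have "m = d + k" by (simp split: if_splits)
    then show ?thesis
      using add_left_mono[OF keys_le_lead_monomial[OF k], of d] assms(3) by (simp add: add.commute)
  qed (rule keys_le_lead_monomial)
  with ne show "m < lead_monomial f" by simp
qed

theorem ideal_gen_chain_stabilises:
  assumes mono: "\<And>N. H N \<subseteq> H (Suc N)" and H: "\<And>N. H N \<subseteq> qpolys n"
  shows "\<exists>N. H (Suc N) \<subseteq> ideal_gen n (H N)"
proof (rule ccontr)
  assume contra: "\<not> ?thesis"
  \<comment> \<open>The polynomials that are new at stage \<open>Suc N\<close>. Each
    \<open>D N\<close> contains a generator by \<open>contra\<close>, and all leading monomials stay
    within \<open>n\<close> indeterminates, so that a least one exists.\<close>
  define D where "D N = ideal_gen n (H (Suc N)) - ideal_gen n (H N)" for N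
  have D_qpolys: "p \<in> qpolys n" if "p \<in> D N" for p N
    using that ideal_gen_subset_qpolys[OF H] by (auto simp: D_def)
  have zero: "0 \<in> ideal_gen n G" for G unfolding ideal_gen_def by (auto intro!: exI[of _ "[]"])
  have D_nz: "p \<noteq> 0" if "p \<in> D N" for p N using that zero by (auto simp: D_def)
  have lm: "Poly_Mapping.keys (lead_monomial p) \<subseteq> {..<n}" if "p \<in> D N" for p N
    using D_qpolys[OF that] lead_monomial_in_keys[OF D_nz[OF that]] by (auto simp: qpolys_def)
  have "\<exists>f\<in>D N. \<forall>p\<in>D N. lead_monomial f \<le> lead_monomial p" for N
  proof -
    have "D N \<noteq> {}" using contra ideal_gen_base[of _ "H (Suc N)" n] by (auto simp: D_def)
    then show ?thesis using ex_min_monomial[of "lead_monomial ` D N" n] lm by blast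
  qed
  then obtain f where f: "\<And>N. f N \<in> D N" "\<And>N p. p \<in> D N \<Longrightarrow> lead_monomial (f N) \<le> lead_monomial p"
    by metis
  obtain i j d where ij: "i < j" "lead_monomial (f j) = lead_monomial (f i) + d"
    using dickson[of "\<lambda>i. lead_monomial (f i)" n] lm[OF f(1)] by blast
  obtain c where c: "\<And>m. m \<in> Poly_Mapping.keys (f j + Poly_Mapping.single d c * f i) \<Longrightarrow>
      m < lead_monomial (f j)"
    using lead_reduction[OF D_nz[OF f(1)] D_nz[OF f(1)] ij(2)] by blast
  have "Poly_Mapping.keys d \<subseteq> Poly_Mapping.keys (lead_monomial (f j))"
    unfolding ij(2) by (auto simp: in_keys_iff lookup_add)
  then have d: "Poly_Mapping.single d b \<in> qpolys n" for b
    using lm[OF f(1)] by (intro qpolys_single) blast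
  \<comment> \<open>As \<open>i < j\<close>, the polynomial \<open>f i\<close> belongs to the ideal
    at stage \<open>j\<close> already, so subtracting a multiple of it does not change whether
    \<open>f j\<close> is new.\<close>
  have chain: "H (Suc i) \<subseteq> H j" using lift_Suc_mono_le[of H, OF mono] ij(1) by (simp add: Suc_le_eq)
  have fi: "f i \<in> ideal_gen n (H j)" using f(1)[of i] ideal_gen_mono[OF chain] by (auto simp: D_def)
  let ?h = "f j + Poly_Mapping.single d c * f i"
  have "?h \<in> ideal_gen n (H (Suc j))"
    using f(1)[of j] fi ideal_gen_mono[OF mono] d by (auto simp: D_def intro!: ideal_gen_add ideal_gen_mult)
  moreover have "?h \<notin> ideal_gen n (H j)"
  proof
    assume "?h \<in> ideal_gen n (H j)"
    from ideal_gen_add[OF this ideal_gen_mult[OF fi d[of "- c"]]]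
    have "f j \<in> ideal_gen n (H j)" by (simp add: single_uminus)
    with f(1)[of j] show False by (simp add: D_def)
  qed
  ultimately have "?h \<in> D j" by (simp add: D_def)
  then show False
    using f(2)[of ?h j] c[OF lead_monomial_in_keys[OF D_nz[of ?h j]]] by simp
qed


section \<open>Computing with codes of polynomials\<close>

text \<open>The length is the maximum of the two lengths, by truncated subtraction.\<close>

definition exp_add :: "nat list \<Rightarrow> nat list \<Rightarrow> nat list" where
  "exp_add d e = map (\<lambda>i. nth_default 0 d i + nth_default 0 e i)
     [0..<length d + (length e - length d)]"

definition term_mult :: "qterm \<Rightarrow> qterm \<Rightarrow> qterm" where
  "term_mult s t = (exp_add (fst s) (fst t), fst (snd s) * fst (snd t), snd (snd s) * snd (snd t))"

text \<open>Like terms are not collected; repeated monomials are summed only by the test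
  \<open>is_zero\<close>.\<close>

definition terms_mult :: "qterm list \<Rightarrow> qterm list \<Rightarrow> qterm list" where
  "terms_mult ss ts = concat (map (\<lambda>s. map (\<lambda>t. term_mult s t) ts) ss)"

definition terms_power :: "nat \<Rightarrow> qterm list \<Rightarrow> nat \<Rightarrow> qterm list" where
  "terms_power n ts k = rec_nat [(replicate n 0, 1, 1)] (\<lambda>_ us. terms_mult ts us) k"

text \<open>The fold starts from the bare coefficient of the term, written with \<open>n\<close>
  zero exponents, and multiplies in a power of one component of \<open>F\<close> per
  indeterminate.\<close>

definition term_subst :: "nat \<Rightarrow> qterm list list \<Rightarrow> qterm \<Rightarrow> qterm list" where
  "term_subst n F t = foldr (\<lambda>i us.
     terms_mult (terms_power n (nth_default [] F i) (nth_default 0 (fst t) i)) us)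
     [0..<n] [(replicate n 0, snd t)]"

definition terms_subst :: "nat \<Rightarrow> qterm list list \<Rightarrow> qterm list \<Rightarrow> qterm list" where
  "terms_subst n F ts = concat (map (\<lambda>t. term_subst n F t) ts)"

text \<open>
  Candidate certificates may contain denominators 0. Such a term stands for 0, since \<open>a / 0 = 0\<close>,
  and has to be left out when fractions are added by cross multiplication.
\<close>

definition coeff_sum :: "nat list \<Rightarrow> qterm list \<Rightarrow> int \<times> nat" where
  "coeff_sum e ts = foldr (\<lambda>t s. if fst t = e \<and> snd (snd t) \<noteq> 0
     then (fst s * int (snd (snd t)) + fst (snd t) * int (snd s), snd s * snd (snd t)) else s)
     ts (0, 1)"

text \<open>Exponent lists are compared literally. If all sums vanish then the polynomial is 0 in
  any case; the converse holds when the lists have a common length.\<close>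

definition is_zero :: "qterm list \<Rightarrow> bool" where
  "is_zero ts \<longleftrightarrow> (\<forall>t\<in>set ts. fst (coeff_sum (fst t) ts) = 0)"

definition orbit :: "nat \<Rightarrow> qterm list list \<Rightarrow> qterm list list list \<Rightarrow> nat \<Rightarrow> qterm list list" where
  "orbit n gs Fs N = rec_nat gs
     (\<lambda>_ H. gs @ concat (map (\<lambda>F. map (\<lambda>h. terms_subst n F h) H) Fs)) N"

text \<open>The combination is added to \<open>h\<close>, so its cofactors carry the opposite sign.
  Membership in \<open>set H\<close> is spelled out by a bounded quantifier and an equality, to
  which the decidability rules apply.\<close>

definition certifies ::
    "qterm list list \<Rightarrow> qterm list list \<Rightarrow> (qterm list \<times> qterm list) list list \<Rightarrow> bool" where
  "certifies H H' Ls \<longleftrightarrow> (\<forall>h\<in>set H'. \<exists>L\<in>set Ls. (\<forall>p\<in>set L. \<exists>h'\<in>set H. snd p = h') \<and>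
     is_zero (h @ concat (map (\<lambda>p. terms_mult (fst p) (snd p)) L)))"

section \<open>Computability of the operations on term lists\<close>

lemma computable_exp_add [computable_intros]:
  "computable f \<Longrightarrow> computable g \<Longrightarrow> computable (\<lambda>x. exp_add (f x) (g x))"
  by (rule computable_comp2) (unfold exp_add_def, intro computable_intros)

lemma computable_term_mult [computable_intros]:
  "computable f \<Longrightarrow> computable g \<Longrightarrow> computable (\<lambda>x. term_mult (f x) (g x))"
  unfolding term_mult_def by (intro computable_intros)

lemma computable_terms_mult [computable_intros]:
  "computable f \<Longrightarrow> computable g \<Longrightarrow> computable (\<lambda>x. terms_mult (f x) (g x))"
  by (rule computable_comp2) (unfold terms_mult_def, intro computable_intros)

lemma computable_terms_power [computable_intros]:
  "computable f \<Longrightarrow> computable g \<Longrightarrow> computable k \<Longrightarrow> computable (\<lambda>x. terms_power (f x) (g x) (k x))"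
  by (rule computable_comp3) (unfold terms_power_def, intro computable_intros)

lemma computable_term_subst [computable_intros]:
  "computable f \<Longrightarrow> computable g \<Longrightarrow> computable k \<Longrightarrow> computable (\<lambda>x. term_subst (f x) (g x) (k x))"
  by (rule computable_comp3) (unfold term_subst_def, intro computable_intros)

lemma computable_terms_subst [computable_intros]:
  "computable f \<Longrightarrow> computable g \<Longrightarrow> computable k \<Longrightarrow> computable (\<lambda>x. terms_subst (f x) (g x) (k x))"
  by (rule computable_comp3) (unfold terms_subst_def, intro computable_intros)

lemma computable_coeff_sum [computable_intros]:
  "computable f \<Longrightarrow> computable g \<Longrightarrow> computable (\<lambda>x. coeff_sum (f x) (g x))"
  by (rule computable_comp2) (unfold coeff_sum_def, intro computable_intros)

lemma decidable_is_zero [computable_intros]: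
  "computable f \<Longrightarrow> decidable (\<lambda>x. is_zero (f x))"
  by (rule decidable_comp[of is_zero]) (unfold is_zero_def, intro computable_intros)

lemma computable_orbit:
  "computable (\<lambda>x. orbit (fst x) (fst (snd x)) (fst (snd (snd x))) (snd (snd (snd x))))"
  unfolding orbit_def by (intro computable_intros)

lemma decidable_certifies: "decidable (\<lambda>x. certifies (fst x) (fst (snd x)) (snd (snd x)))"
  unfolding certifies_def by (intro computable_intros)


section \<open>Evaluation and correctness\<close>

definition monom_eval :: "(nat \<Rightarrow>\<^sub>0 nat) \<Rightarrow> complex vec \<Rightarrow> complex" where
  "monom_eval m x = (\<Prod>i\<in>Poly_Mapping.keys m. (x $ i) ^ Poly_Mapping.lookup m i)"

lemma monom_eval_superset:
  assumes "finite A" "Poly_Mapping.keys m \<subseteq> A"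
  shows "monom_eval m x = (\<Prod>i\<in>A. (x $ i) ^ Poly_Mapping.lookup m i)"
  unfolding monom_eval_def by (rule prod.mono_neutral_left) (use assms in \<open>auto simp: in_keys_iff\<close>)

lemma monom_eval_zero [simp]: "monom_eval 0 x = 1"
  by (simp add: monom_eval_def)

lemma monom_eval_add: "monom_eval (m + m') x = monom_eval m x * monom_eval m' x"
proof -
  let ?A = "Poly_Mapping.keys m \<union> Poly_Mapping.keys m'"
  have "monom_eval (m + m') x = (\<Prod>i\<in>?A. (x $ i) ^ Poly_Mapping.lookup (m + m') i)"
    by (rule monom_eval_superset) (use Poly_Mapping.keys_add[of m m'] in auto)
  moreover have "monom_eval m x = (\<Prod>i\<in>?A. (x $ i) ^ Poly_Mapping.lookup m i)"
    "monom_eval m' x = (\<Prod>i\<in>?A. (x $ i) ^ Poly_Mapping.lookup m' i)"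
    by (rule monom_eval_superset; simp)+
  ultimately show ?thesis by (simp add: lookup_add power_add prod.distrib)
qed

lemma peval_eq: "peval p x =
    (\<Sum>m\<in>Poly_Mapping.keys p. of_rat (Poly_Mapping.lookup p m) * monom_eval m x)"
  by (simp add: peval_def monom_eval_def)

lemma peval_zero [simp]: "peval 0 x = 0"
  by (simp add: peval_eq)

lemma peval_add: "peval (p + q) x = peval p x + peval q x"
  unfolding peval_eq
  by (rule setsum_keys_plus_distrib[where f = "\<lambda>m c. of_rat c * monom_eval m x"])
    (simp_all add: of_rat_add distrib_right)

lemma peval_single: "peval (Poly_Mapping.single m c) x = of_rat c * monom_eval m x"
  by (simp add: peval_eq)

lemma peval_one [simp]: "peval 1 x = 1"
  by (simp add: peval_eq)

lemma peval_sum: "peval (sum f A) x = (\<Sum>a\<in>A. peval (f a) x)"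
  by (induction A rule: infinite_finite_induct) (simp_all add: peval_add)

lemma peval_mult: "peval (p * q) x = peval p x * peval q x"
proof -
  have "p * q = (\<Sum>m\<in>Poly_Mapping.keys p. \<Sum>k\<in>Poly_Mapping.keys q.
      Poly_Mapping.single (m + k) (Poly_Mapping.lookup p m * Poly_Mapping.lookup q k))"
    by (subst (1 2) poly_mapping_sum_single[symmetric]) (simp add: sum_product mult_single)
  then show ?thesis
    by (simp add: peval_sum peval_single peval_eq[of p] peval_eq[of q] sum_product
        monom_eval_add of_rat_mult mult_ac)
qed


section \<open>Polynomials presented by term lists\<close>

definition terms_poly :: "qterm list \<Rightarrow> qpoly" where
  "terms_poly ts = sum_list (map qterm_poly ts)"

lemma terms_poly_simps [simp]:
  "terms_poly [] = 0"
  "terms_poly (t # ts) = qterm_poly t + terms_poly ts"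
  "terms_poly (ss @ ts) = terms_poly ss + terms_poly ts"
  by (simp_all add: terms_poly_def)

lemma exp_add_length [simp]: "length (exp_add d e) = max (length d) (length e)"
  by (auto simp: exp_add_def)

lemma nth_exp_add: "Poly_Mapping.nth (exp_add d e) = Poly_Mapping.nth d + Poly_Mapping.nth e"
proof (rule poly_mapping_eqI)
  fix i
  show "Poly_Mapping.lookup (Poly_Mapping.nth (exp_add d e)) i =
      Poly_Mapping.lookup (Poly_Mapping.nth d + Poly_Mapping.nth e) i"
  proof (cases "i < max (length d) (length e)")
    case True
    then have "i < length d + (length e - length d)" by linarith
    then show ?thesis by (simp add: lookup_add exp_add_def nth_default_nth)
  next
    case False
    then show ?thesis by (simp add: lookup_add nth_default_beyond not_less)
  qed
qed

lemma qterm_poly_mult: "qterm_poly (term_mult s t) = qterm_poly s * qterm_poly t"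
  by (simp add: qterm_poly_def term_mult_def case_prod_unfold mult_single nth_exp_add)

lemma terms_poly_mult: "terms_poly (terms_mult ss ts) = terms_poly ss * terms_poly ts"
proof -
  have "terms_poly (map (term_mult s) ts) = qterm_poly s * terms_poly ts" for s
    by (induction ts) (simp_all add: qterm_poly_mult distrib_left)
  then show ?thesis
    unfolding terms_mult_def by (induction ss) (simp_all add: distrib_right)
qed

lemma nth_replicate_zero [simp]: "Poly_Mapping.nth (replicate n 0) = 0"
  using nth_trailing_zeros[of "[]" n] by simp

lemma peval_terms_power: "peval (terms_poly (terms_power n ts k)) x = peval (terms_poly ts) x ^ k"
  unfolding terms_power_def
  by (induction k) (simp_all add: terms_poly_mult peval_mult peval_single qterm_poly_def)

lemma peval_qterm:
  assumes "length (fst t) = n"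
  shows "peval (qterm_poly t) x =
    of_rat (of_int (fst (snd t)) / of_nat (snd (snd t))) * (\<Prod>i<n. (x $ i) ^ nth_default 0 (fst t) i)"
proof -
  have "Poly_Mapping.keys (Poly_Mapping.nth (fst t)) \<subseteq> {..<n}"
    using assms by (auto simp: in_keys_iff nth_default_def simp del: keys_nth split: if_splits)
  from monom_eval_superset[OF _ this, of x] show ?thesis
    by (simp add: qterm_poly_def case_prod_unfold peval_single)
qed

lemma peval_terms_subst:
  assumes ts: "set ts \<subseteq> qterms n" and F: "length F = n"
  shows "peval (terms_poly (terms_subst n F ts)) x =
    peval (terms_poly ts) (poly_map (map terms_poly F) x)"
proof -
  let ?y = "poly_map (map terms_poly F) x"
  have "peval (terms_poly (term_subst n F t)) x = peval (qterm_poly t) ?y" if "t \<in> qterms n" for t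
  proof -
    let ?c = "of_rat (of_int (fst (snd t)) / of_nat (snd (snd t)))"
    \<comment> \<open>Stated for an arbitrary index list in place of \<open>[0..<n]\<close>, to make
      the induction possible.\<close>
    have "peval (terms_poly (foldr (\<lambda>i us. terms_mult (terms_power n (nth_default [] F i) (nth_default 0 (fst t) i)) us)
        is [(replicate n 0, snd t)])) x =
        ?c * (\<Prod>i\<leftarrow>is. peval (terms_poly (nth_default [] F i)) x ^ nth_default 0 (fst t) i)" for "is"
      by (induction "is") (simp_all add: terms_poly_mult peval_mult peval_terms_power
          qterm_poly_def case_prod_unfold peval_single)
    then have "peval (terms_poly (term_subst n F t)) x =
        ?c * (\<Prod>i<n. peval (terms_poly (nth_default [] F i)) x ^ nth_default 0 (fst t) i)"
      by (simp add: term_subst_def prod.distinct_set_conv_list[symmetric] atLeast0LessThan)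
    also have "\<dots> = ?c * (\<Prod>i<n. (?y $ i) ^ nth_default 0 (fst t) i)"
      using F by (simp add: poly_map_def nth_default_nth)
    also have "\<dots> = peval (qterm_poly t) ?y"
      using that by (subst peval_qterm[where n = n]) (auto simp: qterms_def)
    finally show ?thesis .
  qed
  with ts show ?thesis
    unfolding terms_subst_def by (induction ts) (auto simp: peval_add)
qed

lemma qterms_mult: "set ss \<subseteq> qterms n \<Longrightarrow> set ts \<subseteq> qterms n \<Longrightarrow> set (terms_mult ss ts) \<subseteq> qterms n"
  by (fastforce simp: terms_mult_def term_mult_def qterms_def)

lemma qterms_power: "set ts \<subseteq> qterms n \<Longrightarrow> set (terms_power n ts k) \<subseteq> qterms n"
  unfolding terms_power_def by (induction k) (simp_all add: qterms_mult, simp add: qterms_def)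

lemma qterms_subst:
  assumes F: "\<And>f. f \<in> set F \<Longrightarrow> set f \<subseteq> qterms n" and ts: "set ts \<subseteq> qterms n"
  shows "set (terms_subst n F ts) \<subseteq> qterms n"
proof -
  have F': "set (nth_default [] F i) \<subseteq> qterms n" for i
    using F by (cases "i < length F") (auto simp: nth_default_nth nth_default_beyond)
  have "set (foldr (\<lambda>i us. terms_mult (terms_power n (nth_default [] F i) (nth_default 0 (fst t) i)) us)
        is [(replicate n 0, snd t)]) \<subseteq> qterms n" if "t \<in> qterms n" for t "is"
  proof (induction "is")
    case Nil
    show ?case using that by (auto simp: qterms_def)
  next
    case (Cons i "is")
    then show ?case by (simp add: qterms_mult qterms_power F')
  qed
  then show ?thesis using ts unfolding terms_subst_def term_subst_def by fastforce
qed

lemma terms_poly_in_qpolys: "set ts \<subseteq> qterms n \<Longrightarrow> terms_poly ts \<in> qpolys n"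
  unfolding terms_poly_def ex_codes_poly_iff[symmetric] codes_poly_def by blast

lemma qpolys_terms: "p \<in> qpolys n \<Longrightarrow> \<exists>ts. set ts \<subseteq> qterms n \<and> terms_poly ts = p"
  unfolding terms_poly_def ex_codes_poly_iff[symmetric] codes_poly_def by blast


section \<open>Comparison of coefficients\<close>

definition coeffs_at :: "nat list \<Rightarrow> qterm list \<Rightarrow> rat" where
  "coeffs_at e ts = (\<Sum>t\<leftarrow>filter (\<lambda>t. fst t = e) ts. of_int (fst (snd t)) / of_nat (snd (snd t)))"

text \<open>Positivity of the denominator has to be carried through the induction, since cross
  multiplication relies on it. The skipped terms contribute \<open>a / 0 = 0\<close>.\<close>

lemma coeff_sum:
  "snd (coeff_sum e ts) > 0 \<and>
    of_int (fst (coeff_sum e ts)) / of_nat (snd (coeff_sum e ts)) = coeffs_at e ts"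
  by (induction ts) (auto simp: coeff_sum_def coeffs_at_def field_simps)

lemma coeff_sum_eq_0_iff: "fst (coeff_sum e ts) = 0 \<longleftrightarrow> coeffs_at e ts = 0"
  using coeff_sum[of e ts] by (metis div_0 divide_eq_0_iff of_int_0 of_int_eq_0_iff of_nat_eq_0_iff less_irrefl)

text \<open>Groups the terms by exponent list. Different lists may stand for the same monomial
  because of trailing zeros, which does no harm to the sum.\<close>

lemma terms_poly_eq_coeffs:
  assumes "finite E" "fst ` set ts \<subseteq> E"
  shows "terms_poly ts = (\<Sum>e\<in>E. Poly_Mapping.single (Poly_Mapping.nth e) (coeffs_at e ts))"
  using assms(2)
proof (induction ts)
  case (Cons t ts)
  have "Poly_Mapping.single (Poly_Mapping.nth e) (coeffs_at e (t # ts)) =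
      (if fst t = e then qterm_poly t else 0) + Poly_Mapping.single (Poly_Mapping.nth e) (coeffs_at e ts)" for e
    by (auto simp: coeffs_at_def single_add qterm_poly_def case_prod_unfold)
  with Cons assms(1) show ?case by (simp add: sum.distrib)
qed (simp add: coeffs_at_def)

text \<open>Soundness of the test, for arbitrary term lists: a certificate found by blind search may
  contain malformed terms.\<close>

lemma is_zero_imp: "is_zero ts \<Longrightarrow> terms_poly ts = 0"
  unfolding terms_poly_eq_coeffs[OF finite_imageI[OF finite_set] subset_refl, of ts]
  by (intro sum.neutral) (simp add: is_zero_def coeff_sum_eq_0_iff)

lemma nth_inject_length:
  assumes "length d = length e" "Poly_Mapping.nth d = Poly_Mapping.nth e"
  shows "d = e"
proof (rule nth_equalityI)
  fix i assume "i < length d"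
  then show "d ! i = e ! i"
    using assms(1) arg_cong[OF assms(2), of "\<lambda>m. Poly_Mapping.lookup m i"] by (simp add: nth_default_nth)
qed (fact assms(1))

text \<open>Completeness of the test. All exponent lists have length \<open>n\<close>, so different
  lists are different monomials, and each tested sum is a coefficient of the polynomial.\<close>

lemma is_zero_if:
  assumes "set ts \<subseteq> qterms n" "terms_poly ts = 0"
  shows "is_zero ts"
  unfolding is_zero_def coeff_sum_eq_0_iff
proof
  fix t assume t: "t \<in> set ts"
  let ?E = "fst ` set ts"
  have len: "length e = n" if "e \<in> ?E" for e using that assms(1) by (auto simp: qterms_def)
  have "Poly_Mapping.lookup (terms_poly ts) (Poly_Mapping.nth (fst t)) =
      (\<Sum>e\<in>?E. if e = fst t then coeffs_at e ts else 0)"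
    unfolding terms_poly_eq_coeffs[OF _ subset_refl, of ts, simplified] lookup_sum
  proof (rule sum.cong)
    fix e assume "e \<in> ?E"
    then have "length e = length (fst t)" using len t by auto
    then show "Poly_Mapping.lookup (Poly_Mapping.single (Poly_Mapping.nth e) (coeffs_at e ts))
        (Poly_Mapping.nth (fst t)) = (if e = fst t then coeffs_at e ts else 0)"
      using nth_inject_length[of e "fst t"] by (auto simp: lookup_single when_def)
  qed simp
  also have "\<dots> = coeffs_at (fst t) ts" using t by simp
  finally show "coeffs_at (fst t) ts = 0" using assms(2) by simp
qed


section \<open>The chain of polynomial sets and its certificates\<close>

lemma orbit_0 [simp]: "orbit n gs Fs 0 = gs"
  by (simp add: orbit_def)

lemma set_orbit_Suc: "set (orbit n gs Fs (Suc N)) =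
    set gs \<union> (\<Union>F\<in>set Fs. terms_subst n F ` set (orbit n gs Fs N))"
  by (simp add: orbit_def)

lemma orbit_mono: "set (orbit n gs Fs N) \<subseteq> set (orbit n gs Fs (Suc N))"
proof (induction N)
  case (Suc N)
  have "set gs \<union> (\<Union>F\<in>set Fs. terms_subst n F ` set (orbit n gs Fs N)) \<subseteq>
      set gs \<union> (\<Union>F\<in>set Fs. terms_subst n F ` set (orbit n gs Fs (Suc N)))"
    by (intro Un_mono UN_mono image_mono subset_refl Suc)
  with set_orbit_Suc[of n gs Fs N] set_orbit_Suc[of n gs Fs "Suc N"] show ?case by (simp only:)
qed (simp add: set_orbit_Suc)

lemma orbit_qterms:
  assumes gs: "set gs \<subseteq> lists (qterms n)" and Fs: "set Fs \<subseteq> lists (lists (qterms n))"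
  shows "set (orbit n gs Fs N) \<subseteq> lists (qterms n)"
proof (induction N)
  case (Suc N)
  have "terms_subst n F h \<in> lists (qterms n)"
    if "F \<in> set Fs" "h \<in> set (orbit n gs Fs N)" for F h
  proof -
    have "set (terms_subst n F h) \<subseteq> qterms n"
      by (rule qterms_subst) (use that Suc Fs in blast)+
    then show ?thesis by blast
  qed
  then show ?case unfolding set_orbit_Suc using gs by blast
qed (use gs in simp)

text \<open>Completeness of the search: a representation in the ideal is rewritten with term lists,
  and the result is well formed, so that the zero test accepts it.\<close>

lemma ex_certificate:
  assumes H: "set H \<subseteq> lists (qterms n)" and H': "set H' \<subseteq> lists (qterms n)"
    and sub: "terms_poly ` set H' \<subseteq> ideal_gen n (terms_poly ` set H)"
  shows "\<exists>Ls. certifies H H' Ls"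
proof -
  let ?cert = "\<lambda>h L. (\<forall>p\<in>set L. \<exists>h'\<in>set H. snd p = h') \<and>
     is_zero (h @ concat (map (\<lambda>p. terms_mult (fst p) (snd p)) L))"
  have "\<forall>h\<in>set H'. \<exists>L. ?cert h L"
  proof
    fix h assume h: "h \<in> set H'"
    obtain L where L: "set L \<subseteq> qpolys n \<times> terms_poly ` set H" "terms_poly h = (\<Sum>(q, g)\<leftarrow>L. q * g)"
      using sub h by (auto simp: ideal_gen_def)
    \<comment> \<open>\<open>M\<close> presents the negated cofactors, as its combination has to
      cancel \<open>h\<close>.\<close>
    have "\<exists>M. set M \<subseteq> lists (qterms n) \<times> set H \<and>
        terms_poly (concat (map (\<lambda>p. terms_mult (fst p) (snd p)) M)) = - (\<Sum>(q, g)\<leftarrow>L. q * g)"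
      using L(1)
    proof (induction L)
      case Nil
      show ?case by (intro exI[of _ "[]"]) simp
    next
      case (Cons a L)
      then obtain M where M: "set M \<subseteq> lists (qterms n) \<times> set H"
        "terms_poly (concat (map (\<lambda>p. terms_mult (fst p) (snd p)) M)) = - (\<Sum>(q, g)\<leftarrow>L. q * g)"
        by auto
      obtain q g where a: "a = (q, terms_poly g)" "q \<in> qpolys n" "g \<in> set H" using Cons.prems by auto
      have "- 1 * q \<in> qpolys n" using a(2) by (intro qpolys_mult) (simp_all add: qpolys_def)
      then obtain ts where ts: "set ts \<subseteq> qterms n" "terms_poly ts = - q"
        using qpolys_terms by fastforce
      show ?case
        by (intro exI[of _ "(ts, g) # M"]) (use M a ts in \<open>auto simp: terms_poly_mult\<close>)
    qed
    then obtain M where M: "set M \<subseteq> lists (qterms n) \<times> set H"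
      "terms_poly (concat (map (\<lambda>p. terms_mult (fst p) (snd p)) M)) = - terms_poly h"
      using L(2) by auto
    have "set (terms_mult (fst p) (snd p)) \<subseteq> qterms n" if "p \<in> set M" for p
      by (rule qterms_mult) (use that M(1) H in fastforce)+
    then have "is_zero (h @ concat (map (\<lambda>p. terms_mult (fst p) (snd p)) M))"
      using h H' M(2) by (intro is_zero_if[of _ n]) auto
    moreover have "\<forall>p\<in>set M. \<exists>h'\<in>set H. snd p = h'" using M(1) by auto
    ultimately show "\<exists>L. ?cert h L" by blast
  qed
  from bchoice[OF this] obtain L where "\<forall>h\<in>set H'. ?cert h (L h)" by blast
  then have "certifies H H' (map L H')" unfolding certifies_def set_map by blast
  then show ?thesis by blast
qed

lemma certifies_peval:
  assumes "certifies H H' Ls" "h \<in> set H'" "\<And>g. g \<in> set H \<Longrightarrow> peval (terms_poly g) x = 0"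
  shows "peval (terms_poly h) x = 0"
proof -
  obtain L where L: "\<forall>p\<in>set L. \<exists>h'\<in>set H. snd p = h'"
    "is_zero (h @ concat (map (\<lambda>p. terms_mult (fst p) (snd p)) L))"
    using assms(1,2) unfolding certifies_def by blast
  have "peval (terms_poly (concat (map (\<lambda>p. terms_mult (fst p) (snd p)) L))) x = 0"
    using L(1) assms(3) by (induction L) (auto simp: peval_add terms_poly_mult peval_mult)
  moreover have "peval (terms_poly h + terms_poly (concat (map (\<lambda>p. terms_mult (fst p) (snd p)) L))) x = 0"
    using is_zero_imp[OF L(2)] by simp
  ultimately show ?thesis by (simp add: peval_add)
qed

text \<open>A point lies in the zero set of stage \<open>Suc M\<close> exactly if it lies in that of
  \<open>gs\<close> and all its images lie in the zero set of stage \<open>M\<close>. The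
  certificate puts the zero set of stage \<open>N\<close> inside that of stage \<open>Suc N\<close>,
  which makes it invariant. Conversely, the invariant set is contained in the zero set of every
  stage.\<close>

lemma certified_zero_set:
  assumes gs: "set gs \<subseteq> lists (qterms n)" and Fs: "set Fs \<subseteq> lists (lists (qterms n))"
    and len: "\<And>F. F \<in> set Fs \<Longrightarrow> length F = n"
    and cert: "certifies (orbit n gs Fs N) (orbit n gs Fs (Suc N)) Ls"
  shows "zero_set n (map terms_poly (orbit n gs Fs N)) =
    invariant_set (map poly_map (map (map terms_poly) Fs)) (zero_set n (map terms_poly gs))"
    (is "?Z N = invariant_set ?Fs ?X")
proof -
  let ?Z = "\<lambda>N. zero_set n (map terms_poly (orbit n gs Fs N))"
  have subst: "peval (terms_poly (terms_subst n F h)) x =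
      peval (terms_poly h) (poly_map (map terms_poly F) x)"
    if "F \<in> set Fs" "h \<in> set (orbit n gs Fs M)" for F h x M
    using that len orbit_qterms[OF gs Fs, of M] by (intro peval_terms_subst) auto
  have carrier: "poly_map (map terms_poly F) x \<in> carrier_vec n" if "F \<in> set Fs" for F x
    using len[OF that] by (simp add: poly_map_def)
  have nth_Fs: "\<exists>F\<in>set Fs. ?Fs ! i = poly_map (map terms_poly F)" if "i < length ?Fs" for i
    using that by (intro bexI[of _ "Fs ! i"]) auto
  have Suc: "?Z N \<subseteq> ?Z (Suc N)"
    using certifies_peval[OF cert] by (auto simp: zero_set_def)
  have Z_Suc: "x \<in> ?Z (Suc M) \<longleftrightarrow> x \<in> ?X \<and> (\<forall>F\<in>set Fs. poly_map (map terms_poly F) x \<in> ?Z M)" for x M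
  proof -
    have "x \<in> ?Z (Suc M) \<longleftrightarrow> x \<in> ?X \<and>
        (\<forall>F\<in>set Fs. \<forall>h\<in>set (orbit n gs Fs M). peval (terms_poly (terms_subst n F h)) x = 0)"
      by (auto simp: zero_set_def set_orbit_Suc)
    also have "\<dots> \<longleftrightarrow> x \<in> ?X \<and> (\<forall>F\<in>set Fs. poly_map (map terms_poly F) x \<in> ?Z M)"
      using carrier by (simp add: zero_set_def subst)
    finally show ?thesis .
  qed
  have "x \<in> invariant_set ?Fs ?X" if x: "x \<in> ?Z N" for x
  proof -
    have "fold (\<lambda>i. ?Fs ! i) is x \<in> ?Z N" if "set is \<subseteq> {..<length ?Fs}" for "is"
      using that x
    proof (induction "is" arbitrary: x)
      case (Cons i "is")
      have "(?Fs ! i) x \<in> ?Z N" using Cons.prems nth_Fs[of i] Suc Z_Suc[of x N] by auto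
      with Cons show ?case by simp
    qed simp
    moreover have "?Z N \<subseteq> ?X" using Suc Z_Suc[of _ N] by blast
    ultimately show ?thesis using x by (auto simp: invariant_set_def)
  qed
  moreover have "x \<in> ?Z M" if "x \<in> invariant_set ?Fs ?X" for x M
    using that
  proof (induction M arbitrary: x)
    case 0
    then show ?case by (simp add: invariant_set_def)
  next
    case (Suc M)
    \<comment> \<open>The invariant set is mapped into itself: an index sequence for the image,
      preceded by the index of \<open>F\<close>, is one for \<open>x\<close>.\<close>
    have "poly_map (map terms_poly F) x \<in> invariant_set ?Fs ?X" if F: "F \<in> set Fs" for F
    proof -
      obtain i where i: "i < length Fs" "F = Fs ! i" using F by (auto simp: in_set_conv_nth)
      have "fold (\<lambda>i. ?Fs ! i) is (poly_map (map terms_poly F) x) \<in> ?X"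
        if "set is \<subseteq> {..<length ?Fs}" for "is"
      proof -
        have "set (i # is) \<subseteq> {..<length ?Fs}" using that i by simp
        then have "fold (\<lambda>i. ?Fs ! i) (i # is) x \<in> ?X"
          using Suc.prems unfolding invariant_set_def by blast
        then show ?thesis using i by simp
      qed
      \<comment> \<open>The empty index sequence gives that the image itself lies in the zero set of
        \<open>gs\<close>.\<close>
      from this this[of "[]"] show ?thesis by (simp add: invariant_set_def)
    qed
    then show ?case using Suc by (simp only: Z_Suc) (simp add: invariant_set_def)
  qed
  ultimately show ?thesis by blast
qed


section \<open>Codes of inputs and the algorithm\<close>

text \<open>The conclusion has the form of the hypothesis, with lists in place of elements, so the
  lemma can be iterated for lists of lists of polynomials.\<close>

lemma codes_list_enc:
  assumes "\<And>c x. R c x \<longleftrightarrow> (\<exists>y\<in>Y. c = enc y \<and> x = f y)"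
  shows "codes_list R c xs \<longleftrightarrow> (\<exists>ys\<in>lists Y. c = enc ys \<and> xs = map f ys)"
proof -
  have "list_all2 R cs xs \<longleftrightarrow> (\<exists>ys\<in>lists Y. cs = map enc ys \<and> xs = map f ys)" for cs
  proof
    assume "list_all2 R cs xs"
    then show "\<exists>ys\<in>lists Y. cs = map enc ys \<and> xs = map f ys"
    proof (induction rule: list_all2_induct)
      case (Cons c cs x xs)
      then obtain y ys where "y \<in> Y" "c = enc y" "x = f y" "ys \<in> lists Y" "cs = map enc ys" "xs = map f ys"
        using assms by auto
      then show ?case by (intro bexI[of _ "y # ys"]) auto
    qed (intro bexI[of _ "[]"], auto)
  next
    assume "\<exists>ys\<in>lists Y. cs = map enc ys \<and> xs = map f ys"
    then show "list_all2 R cs xs" using assms by (auto simp: list_all2_map1 list_all2_map2 intro!: list.rel_refl_strong)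
  qed
  then show ?thesis by (auto simp: codes_list_def enc_list_def)
qed

lemma enc_qterm: "enc t = qterm_encode t"
  by (cases t) (simp add: qterm_encode_def enc_prod_def enc_int_def enc_list_def enc_nat_def[abs_def])

lemma codes_poly_enc: "codes_poly n c p \<longleftrightarrow> (\<exists>ts\<in>lists (qterms n). c = enc ts \<and> p = terms_poly ts)"
  by (auto simp: codes_poly_def enc_list_def terms_poly_def lists_eq_set enc_qterm[abs_def])

theorem theorem4p14:
  shows "\<exists>A :: recf. \<forall>(n :: nat) (gs :: qpoly list) (Fs :: qpoly list list) (c :: nat).
    set gs \<subseteq> qpolys n \<longrightarrow> set Fs \<subseteq> qpoly_maps n \<longrightarrow> codes_input c n gs Fs \<longrightarrow>
    (\<exists>(d :: nat) (hs :: qpoly list).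
       evals A [c] d \<and> set hs \<subseteq> qpolys n \<and> codes_list (codes_poly n) d hs \<and>
       zero_set n hs = invariant_set (map poly_map Fs) (zero_set n gs))"
proof -
  define orb where "orb = (\<lambda>(i :: nat \<times> qterm list list \<times> qterm list list list) N.
    orbit (fst i) (fst (snd i)) (snd (snd i)) N)"
  \<comment> \<open>A witness is a stage together with representations for the elements of the next
    stage; the input is a triple of dimension and term lists.\<close>
  define Q where "Q = (\<lambda>p :: (nat \<times> qterm list list \<times> qterm list list list) \<times>
      nat \<times> (qterm list \<times> qterm list) list list.
    certifies (orb (fst p) (fst (snd p))) (orb (fst p) (Suc (fst (snd p)))) (snd (snd p)))"
  have orb: "computable (\<lambda>x. orb (f x) (g x))" if "computable f" "computable g" for f g
    unfolding orb_def
    using computable_comp[OF computable_orbit, of "\<lambda>x. (fst (f x), fst (snd (f x)), snd (snd (f x)), g x)"] that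
    by (simp add: computable_intros)
  have "decidable Q"
    unfolding Q_def
    using decidable_comp[OF decidable_certifies, of "\<lambda>p. (orb (fst p) (fst (snd p)),
        orb (fst p) (Suc (fst (snd p))), snd (snd p))"]
    by (simp add: computable_intros orb)
  moreover have "computable (\<lambda>p. orb (fst p) (fst (snd p)))"
    by (intro orb computable_intros)
  ultimately have "\<exists>A. \<forall>i. (\<exists>w. Q (i, w)) \<longrightarrow>
      (\<exists>w. Q (i, w) \<and> evals A [enc i] (enc (orb (fst (i, w)) (fst (snd (i, w))))))"
    by (rule computable_search)
  then obtain A where A: "\<And>i. \<exists>w. Q (i, w) \<Longrightarrow>
      \<exists>w. Q (i, w) \<and> evals A [enc i] (enc (orb (fst (i, w)) (fst (snd (i, w)))))"
    by blast
  show ?thesis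
  proof (intro exI[of _ A] allI impI)
    fix n gs Fs c
    assume maps: "set Fs \<subseteq> qpoly_maps n" and "codes_input c n gs Fs"
    then obtain cg cF where c: "c = prod_encode (n, prod_encode (cg, cF))"
      and cg: "codes_list (codes_poly n) cg gs" and cF: "codes_list (codes_list (codes_poly n)) cF Fs"
      by (auto simp: codes_input_def)
    note codes_polys = codes_list_enc[OF codes_poly_enc]
    \<comment> \<open>The program works on the presentations that the code \<open>c\<close> stands
      for, so its output may depend on the code and not only on the polynomials.\<close>
    obtain gs' where gs': "set gs' \<subseteq> lists (qterms n)" "cg = enc gs'" "gs = map terms_poly gs'"
      using cg unfolding codes_polys by (auto simp: lists_eq_set)
    obtain Fs' where Fs': "set Fs' \<subseteq> lists (lists (qterms n))" "cF = enc Fs'"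
      "Fs = map (map terms_poly) Fs'"
      using cF unfolding codes_list_enc[OF codes_polys] by (auto simp: lists_eq_set)
    have len: "length F = n" if "F \<in> set Fs'" for F
      using that maps Fs'(3) by (auto simp: qpoly_maps_def)
    let ?i = "(n, gs', Fs')"
    have c': "c = enc ?i" by (simp add: c gs' Fs' enc_prod_def enc_nat_def)
    have qt: "set (orbit n gs' Fs' N) \<subseteq> lists (qterms n)" for N
      by (rule orbit_qterms[OF gs'(1) Fs'(1)])
    have qp: "terms_poly ` set (orbit n gs' Fs' N) \<subseteq> qpolys n" for N
      using qt[of N] by (fastforce simp: lists_eq_set intro!: terms_poly_in_qpolys)
    have "\<exists>N. terms_poly ` set (orbit n gs' Fs' (Suc N)) \<subseteq>
        ideal_gen n (terms_poly ` set (orbit n gs' Fs' N))"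
      by (rule ideal_gen_chain_stabilises[where H = "\<lambda>N. terms_poly ` set (orbit n gs' Fs' N)",
            OF image_mono[OF orbit_mono] qp])
    then obtain N where N: "terms_poly ` set (orbit n gs' Fs' (Suc N)) \<subseteq>
        ideal_gen n (terms_poly ` set (orbit n gs' Fs' N))" ..
    from ex_certificate[OF qt qt N]
    obtain Ls where "certifies (orbit n gs' Fs' N) (orbit n gs' Fs' (Suc N)) Ls" ..
    then have "Q (?i, (N, Ls))" by (simp add: Q_def orb_def)
    \<comment> \<open>Stabilisation only ensures that the search succeeds. It may stop at another
      stage, so the old \<open>N\<close> is replaced by the stage that was found, which is certified
      too.\<close>
    then obtain N Ls where Q: "Q (?i, (N, Ls))" and ev: "evals A [c] (enc (orbit n gs' Fs' N))"
      using A[of ?i] unfolding c' by (auto simp: orb_def)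
    let ?H = "orbit n gs' Fs' N"
    have "zero_set n (map terms_poly ?H) = invariant_set (map poly_map Fs) (zero_set n gs)"
      unfolding gs'(3) Fs'(3)
      by (rule certified_zero_set[OF gs'(1) Fs'(1) len]) (use Q in \<open>auto simp: Q_def orb_def\<close>)
    moreover have "set (map terms_poly ?H) \<subseteq> qpolys n" using qp by simp
    moreover have "codes_list (codes_poly n) (enc ?H) (map terms_poly ?H)"
      unfolding codes_polys using qt[of N] by (auto simp: lists_eq_set)
    ultimately show "\<exists>d hs. evals A [c] d \<and> set hs \<subseteq> qpolys n \<and> codes_list (codes_poly n) d hs \<and>
        zero_set n hs = invariant_set (map poly_map Fs) (zero_set n gs)"
      using ev by blast
  qed
qed

end
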